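(* Let $k,d\ge 1$, let $A\in\{0,1\}^{k\times k}$ be a primitive matrix, and let $M\in\{0,1\}^{d\times d}$ be such that the Markov-Cayley tree $\Sigma_M^{\ast}$ is a complete recursive tree and $M$ has exactly one full row (a row all of whose entries are $1$). Let $\mathcal{T}_A$ be the Markov hom tree-shift on $\Sigma_M^{\ast}$ associated with $A$. Then for every eventually periodic ray $p\in\partial\Sigma_M^{\ast}$, $$\lim_{n\to\infty}h^{n}(\mathcal{T}_A,p)=h(\mathcal{T}_A),$$ where $h^n(\mathcal{T}_A,p)$ is the $n$-strip entropy of $\mathcal{T}_A$ along $p$ and $h(\mathcal{T}_A)$ is the entropy of $\mathcal{T}_A$.
   Context: Markov-Cayley tree. Let $\Sigma=\{f_1,\ldots,f_d\}$, with the rows and columns of $M$ indexed by $f_1,\ldots,f_d$. For $n\ge 0$, $\Sigma_M^{n}$ is the set of words $\omega=(\omega_1,\ldots,\omega_n)$ over $\Sigma$ of length $n$ with $M(\omega_i,\omega_{i+1})=1$ for $1\le i\le n-1$; $\Sigma_M^0=\{\epsilon\}$ with $\epsilon$ the empty word. The Markov-Cayley tree is $\Sigma_M^{\ast}=\bigcup_{n\ge 0}\Sigma_M^n$, with root $\epsilon$; the length of a word $\omega$ is denoted $|\omega|$. Put $\Delta_n=\bigcup_{i=0}^n\Sigma_M^i$. Complete recursive tree. For $u,v\in\Sigma_M^{\ast}$ write $v\le u$ if $v$ is a prefix of $u$. A finite set $S$ of nonempty words in $\Sigma_M^{\ast}$ is a complete prefix set (CPS) if for every $u\in\Sigma_M^{\ast}$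 with $|u|\ge\max\{|v|:v\in S\}$ there exists $v\in S$ with $v\le u$, and $v\nleq v'$ for all distinct $v,v'\in S$. The follower set of $u\in\Sigma_M^{\ast}$ is $F_M(u)=\{v\in\Sigma_M^{\ast}: uv\in\Sigma_M^{\ast}\}$. The tree $\Sigma_M^{\ast}$ is a complete recursive tree if there is a CPS $S$ of $\Sigma_M^{\ast}$ such that $F_M(u)=\Sigma_M^{\ast}$ for all $u\in S$. Rays. The boundary $\partial\Sigma_M^{\ast}$ is the set of all rays $p=(p_0,p_1,p_2,\ldots)$ with $p_0=\epsilon$ and $p_n=f_{i_1}f_{i_2}\cdots f_{i_n}\in\Sigma_M^n$ for all $n\ge 1$, for some infinite sequence of letters $f_{i_1},f_{i_2},\ldots$. The ray $p$ is eventually periodic if there exist integers $\ell\ge 1$ and $c\ge 0$ such that $f_{i_{j+\ell}}=f_{i_j}$ for all $j>c$. Tree-shift. Let $\mathcal{A}=\{1,\ldots,k\}$. The Markov hom tree-shift is $$\mathcal{T}_A=\{t\in\mathcal{A}^{\Sigma_M^{\ast}}: A(t_\omega,t_{\omega f})=1\text{ for all }\omega\in\Sigma_M^{\ast},\ f\in\Sigma\text{ with }\omega f\in\Sigma_M^{\ast}\}.$$ For finite $F\subseteq\Sigma_M^{\ast}$, $\mathcal{P}(F,\mathcal{T}_A)=\{(t_\omega)_{\omega\in F}: t\in\mathcal{T}_A\}\subseteq\mathcal{A}^F$. Entropy. $h(\mathcal{T}_A)=\lim_{n\to\infty}\dfrac{\log|\mathcal{P}(\Delta_n,\mathcal{T}_A)|}{|\Delta_n|}$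 (the existence of this limit is taken as known). Strip entropy. For a ray $p=(p_0,p_1,p_2,\ldots)\in\partial\Sigma_M^{\ast}$, $n\ge 1$ and $j\ge 0$, let $$\Lambda^n(p_j)=\{p_j\omega\in\Sigma_M^{\ast}: |p_j\omega|\le j+n-1,\ \text{and either }\omega=\epsilon\text{ or the first letter }\omega_1\text{ of }\omega\text{ satisfies }p_j\omega_1\neq p_{j+1}\},$$ for $m\ge 1$ let $\Lambda^n_m(p)=\bigcup_{j=0}^{m-1}\Lambda^n(p_j)$, and define $$h^n(\mathcal{T}_A,p)=\limsup_{m\to\infty}\frac{\log|\mathcal{P}(\Lambda_m^n(p),\mathcal{T}_A)|}{|\Lambda_m^n(p)|}.$$ A nonnegative square matrix is primitive if some power of it has all entries strictly positive. *)

theory Defs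
  imports "HOL-Analysis.Analysis" "HOL-Library.Sublist"
begin

text \<open>
  The alphabet \<open>\<A>\<close> and the set of letters \<open>\<Sigma>\<close> are the finite index types \<open>'k\<close> and \<open>'d\<close> of the
  square matrices \<open>A\<close> and \<open>M\<close>, so that \<open>k = CARD('k)\<close> and \<open>d = CARD('d)\<close> are arbitrary
  positive numbers.  Words over \<open>\<Sigma>\<close> are lists, the root is \<^term>\<open>[]\<close>.
\<close>

section \<open>Matrices\<close>

definition zero_one_matrix :: "real ^ 'n ^ 'n \<Rightarrow> bool" where
  "zero_one_matrix A \<longleftrightarrow> (\<forall>i j. A $ i $ j \<in> {0, 1})"

definition matrix_power :: "real ^ 'n ^ 'n \<Rightarrow> nat \<Rightarrow> real ^ 'n ^ 'n" where
  "matrix_power A m = (((**) A) ^^ m) (mat 1)"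

text \<open>The exponent has to be positive: otherwise the \<open>1 \<times> 1\<close> zero matrix would be primitive.\<close>

definition primitive_matrix :: "real ^ 'n ^ 'n \<Rightarrow> bool" where
  "primitive_matrix A \<longleftrightarrow>
     (\<forall>i j. 0 \<le> A $ i $ j) \<and> (\<exists>m\<ge>1. \<forall>i j. 0 < matrix_power A m $ i $ j)"

definition full_row :: "real ^ 'n ^ 'n \<Rightarrow> 'n \<Rightarrow> bool" where
  "full_row M f \<longleftrightarrow> (\<forall>g. M $ f $ g = 1)"

section \<open>Markov-Cayley trees\<close>

definition tree_level :: "real ^ 'd ^ 'd \<Rightarrow> nat \<Rightarrow> 'd list set" where
  "tree_level M n = {w. length w = n \<and> successively (\<lambda>f g. M $ f $ g = 1) w}"

definition mc_tree :: "real ^ 'd ^ 'd \<Rightarrow> 'd list set" where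
  "mc_tree M = (\<Union>n. tree_level M n)"

definition tree_ball :: "real ^ 'd ^ 'd \<Rightarrow> nat \<Rightarrow> 'd list set" where
  "tree_ball M n = (\<Union>i\<le>n. tree_level M i)"

text \<open>
  Nonemptiness of \<open>S\<close> is what makes the maximum meaningful; for \<open>S = {}\<close>, with the maximum
  read as \<open>0\<close>, the covering condition would fail at the root.
\<close>

definition complete_prefix_set :: "real ^ 'd ^ 'd \<Rightarrow> 'd list set \<Rightarrow> bool" where
  "complete_prefix_set M S \<longleftrightarrow>
     finite S \<and> S \<noteq> {} \<and> S \<subseteq> mc_tree M - {[]} \<and>
     (\<forall>u\<in>mc_tree M. Max (length ` S) \<le> length u \<longrightarrow> (\<exists>v\<in>S. prefix v u)) \<and>
     (\<forall>v\<in>S. \<forall>v'\<in>S. v \<noteq> v' \<longrightarrow> \<not> prefix v v')"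

definition follower_set :: "real ^ 'd ^ 'd \<Rightarrow> 'd list \<Rightarrow> 'd list set" where
  "follower_set M u = {v \<in> mc_tree M. u @ v \<in> mc_tree M}"

definition complete_recursive_tree :: "real ^ 'd ^ 'd \<Rightarrow> bool" where
  "complete_recursive_tree M \<longleftrightarrow>
     (\<exists>S. complete_prefix_set M S \<and> (\<forall>u\<in>S. follower_set M u = mc_tree M))"

section \<open>Rays\<close>

text \<open>
  \<open>x j\<close> is the \<open>j\<close>-th letter \<open>f\<^bsub>i\<^sub>j\<^esub>\<close> for \<open>j \<ge> 1\<close>; the value \<open>x 0\<close> is irrelevant.
\<close>

definition spelled_by :: "(nat \<Rightarrow> 'd list) \<Rightarrow> (nat \<Rightarrow> 'd) \<Rightarrow> bool" where
  "spelled_by p x \<longleftrightarrow> (\<forall>n. p n = map x [1..<Suc n])"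

definition tree_boundary :: "real ^ 'd ^ 'd \<Rightarrow> (nat \<Rightarrow> 'd list) set" where
  "tree_boundary M = {p. (\<exists>x. spelled_by p x) \<and> (\<forall>n. p n \<in> tree_level M n)}"

definition eventually_periodic :: "(nat \<Rightarrow> 'd list) \<Rightarrow> bool" where
  "eventually_periodic p \<longleftrightarrow>
     (\<exists>x. spelled_by p x \<and> (\<exists>l\<ge>1. \<exists>c. \<forall>j>c. x (j + l) = x j))"

section \<open>Hom tree-shifts and entropies\<close>

definition hom_tree_shift :: "real ^ 'k ^ 'k \<Rightarrow> real ^ 'd ^ 'd \<Rightarrow> ('d list \<Rightarrow> 'k) set" where
  "hom_tree_shift A M =
     {t \<in> mc_tree M \<rightarrow>\<^sub>E UNIV.
        \<forall>w\<in>mc_tree M. \<forall>f. w @ [f] \<in> mc_tree M \<longrightarrow> A $ t w $ t (w @ [f]) = 1}"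

definition patterns :: "'d list set \<Rightarrow> ('d list \<Rightarrow> 'k) set \<Rightarrow> ('d list \<Rightarrow> 'k) set" where
  "patterns F T = (\<lambda>t. restrict t F) ` T"

definition tree_entropy :: "real ^ 'k ^ 'k \<Rightarrow> real ^ 'd ^ 'd \<Rightarrow> real" where
  "tree_entropy A M =
     lim (\<lambda>n. ln (real (card (patterns (tree_ball M n) (hom_tree_shift A M))))
              / real (card (tree_ball M n)))"

definition branch :: "real ^ 'd ^ 'd \<Rightarrow> (nat \<Rightarrow> 'd list) \<Rightarrow> nat \<Rightarrow> nat \<Rightarrow> 'd list set" where
  "branch M p n j =
     {p j @ w | w. p j @ w \<in> mc_tree M \<and> length (p j @ w) \<le> j + n - 1 \<and>
                   (w = [] \<or> p j @ [hd w] \<noteq> p (Suc j))}"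

definition strip :: "real ^ 'd ^ 'd \<Rightarrow> (nat \<Rightarrow> 'd list) \<Rightarrow> nat \<Rightarrow> nat \<Rightarrow> 'd list set" where
  "strip M p n m = (\<Union>j<m. branch M p n j)"

text \<open>The upper limit is taken in \<^typ>\<open>ereal\<close>, where it always exists.\<close>

definition strip_entropy ::
    "real ^ 'k ^ 'k \<Rightarrow> real ^ 'd ^ 'd \<Rightarrow> nat \<Rightarrow> (nat \<Rightarrow> 'd list) \<Rightarrow> ereal" where
  "strip_entropy A M n p =
     limsup (\<lambda>m. ereal (ln (real (card (patterns (strip M p n m) (hom_tree_shift A M))))
                        / real (card (strip M p n m))))"

end

theory Submission
  imports Defs
begin

text \<open>
  Two facts drive the proof. Once the label of a vertex is fixed, its children are labeled
  independently, so the logarithm of the number of labelings of a finite tree is, up to \<open>log k\<close>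
  per vertex at which it is cut, the sum of the logarithms for the subtrees. And every word of some
  fixed length \<open>N\<close> contains the letter \<open>f\<close> of the full row, below which hangs a copy of
  the whole tree.
  
  Let \<open>S n\<close> be the size of the ball of depth \<open>n\<close>, \<open>X n\<close> the logarithm of the number of its
  labelings and \<open>V n i\<close> the logarithm of the number of those with root label \<open>i\<close>. Cutting the ball
  at the first occurrences of \<open>f\<close> expresses \<open>S n\<close> through earlier values of \<open>S\<close>, while \<open>X\<close> is
  subadditive and \<open>min V\<close> superadditive for the same cut (\<open>first_passage\<close>). After a shift
  of \<open>S\<close> and \<open>X\<close> by constants, \<open>X n / S n\<close> is at most, and \<open>min V n / S n\<close> at least, a weighted mean
  of earlier values. So the upper limit \<open>U\<close> of the one and the lower limit \<open>L\<close> of the other could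
  differ only if no value ever improved on them; but the child \<open>f\<close> carries a weight
  bounded away from \<open>0\<close>. If \<open>X q / S q\<close> lies below \<open>(U + L) / 2\<close>, this weight pulls all later upper
  ratios below \<open>U\<close>. If it lies above, some root label is as good as the total at depth \<open>q\<close>, and since
  \<open>A\<close> is primitive, every label leads to it along the path \<open>f f \<dots> f\<close>; this pulls all later lower ratios
  above \<open>L\<close>. Hence \<open>U = L\<close> (\<open>upper_rate_eq_lower_rate\<close>). The common value \<open>h\<close> is the entropy,
  and it is reached uniformly over the root labels.
  
  A strip is a path with subtrees hanging off it. On balls \<open>X - (h + \<epsilon>) S\<close> is bounded above and
  \<open>min V - (h - \<epsilon>) S\<close> is bounded below. Both bounds carry over to all hanging subtrees, whatever
  letter and depth they have, and so on a strip of length \<open>m\<close> they hold up to a constant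
  times \<open>m\<close> (\<open>subadditive_spine\<close>). As the ray meets \<open>f\<close> at
  least once in \<open>N\<close> steps, and at least \<open>n - 1\<close> vertices hang off it there, the strip has
  about \<open>m n / N\<close> vertices or more (\<open>card_spine_visits\<close>), so this error is negligible for
  large \<open>n\<close>. These estimates need a second way back to \<open>f\<close> besides the child \<open>f\<close>; by
  \<open>prefixes_return\<close> it exists unless \<open>f\<close> is the only letter, and then strips are balls and
  Fekete's lemma gives the limit.
\<close>

section \<open>Limits of real sequences\<close>

lemma eventually_imp_affine_bound:
  fixes f g :: "nat \<Rightarrow> real"
  assumes "\<And>r. n \<le> r \<Longrightarrow> f r \<le> g r"
  shows "\<exists>K. \<forall>r. f r \<le> g r + K"
proof -
  define K where "K = (\<Sum>r<n. \<bar>f r - g r\<bar>)"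
  have "f r \<le> g r + K" for r
  proof (cases "r < n")
    case True
    then have "\<bar>f r - g r\<bar> \<le> K" unfolding K_def by (intro member_le_sum) auto
    then show ?thesis by linarith
  next
    case False
    moreover have "0 \<le> K" by (simp add: K_def sum_nonneg)
    ultimately show ?thesis using assms[of r] by simp
  qed
  then show ?thesis by blast
qed

text \<open>
  Fekete's lemma: division with remainder by \<open>q\<close> gives \<open>a n \<le> (n div q) * a q + C\<close>, so every
  quotient \<open>a q / q\<close> is an upper bound for the upper limit.
\<close>

lemma subadditive_sequence_converges:
  fixes a :: "nat \<Rightarrow> real"
  assumes sub: "\<And>m n. a (m + n) \<le> a m + a n" and nonneg: "\<And>n. 0 \<le> a n"
  shows "\<exists>h. (\<lambda>n. a n / real n) \<longlonglongrightarrow> h"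
proof -
  define h where "h = (INF n\<in>{1..}. a n / real n)"
  have bdd: "bdd_below ((\<lambda>n. a n / real n) ` {1..})"
    using nonneg by (intro bdd_belowI[of _ 0]) auto
  have mult: "a (k * q + r) \<le> real k * a q + a r" for k q r
  proof (induction k)
    case (Suc k)
    then show ?case using sub[of q "k * q + r"] by (simp add: algebra_simps)
  qed simp
  have "(\<lambda>n. a n / real n) \<longlonglongrightarrow> h"
  proof (rule tendstoI)
    fix \<epsilon> :: real assume "0 < \<epsilon>"
    obtain q where q: "1 \<le> q" "a q / real q < h + \<epsilon> / 2"
      using cINF_less_iff[OF _ bdd, of "h + \<epsilon> / 2"] \<open>0 < \<epsilon>\<close> by (auto simp: h_def)
    define C where "C = (\<Sum>r<q. a r)"
    have C: "a (n mod q) \<le> C" for n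
      unfolding C_def using q nonneg by (intro member_le_sum) auto
    have upper: "a n \<le> (h + \<epsilon> / 2) * real n + C" for n
    proof -
      have "a n \<le> real (n div q) * a q + a (n mod q)"
        using mult[of "n div q" q "n mod q"] by simp
      also have "real (n div q) * a q \<le> real n / real q * a q"
        using nonneg[of q] by (intro mult_right_mono of_nat_div_le_of_nat)
      also have "\<dots> = a q / real q * real n" by simp
      also have "\<dots> \<le> (h + \<epsilon> / 2) * real n"
        using q(2) by (intro mult_right_mono) auto
      finally show ?thesis using C[of n] by linarith
    qed
    obtain n0 where n0: "2 * C / \<epsilon> < real n0" using reals_Archimedean2 by blast
    have "dist (a n / real n) h < \<epsilon>" if "max 1 n0 \<le> n" for n
    proof -
      have "0 < real n" using that by simp
      have "h \<le> a n / real n"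
        unfolding h_def using that by (intro cINF_lower bdd) auto
      moreover have "C < \<epsilon> / 2 * real n"
      proof -
        have "2 * C / \<epsilon> < real n" using n0 that by simp
        then show ?thesis using \<open>0 < \<epsilon>\<close> by (simp add: field_simps)
      qed
      then have "a n < (h + \<epsilon>) * real n"
        using upper[of n] by (simp add: algebra_simps)
      then have "a n / real n < h + \<epsilon>"
        using \<open>0 < real n\<close> by (simp add: pos_divide_less_eq)
      ultimately show ?thesis by (simp add: dist_real_def)
    qed
    then show "eventually (\<lambda>n. dist (a n / real n) h < \<epsilon>) sequentially"
      unfolding eventually_sequentially by blast
  qed
  then show ?thesis by blast
qed

section \<open>Comparison of sequences with the same branching recursion\<close>

text \<open>
  In the application \<open>S n\<close> is the size of the ball of depth \<open>n\<close>, \<open>X n\<close> the logarithm of the number of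
  its labelings and \<open>V n i\<close> the same with root label \<open>i\<close>. The term without coefficient in the
  recursions belongs to the child \<open>f\<close> of the root; it is kept apart because one chooses the label of this
  child along a walk in \<open>E\<close>. The coefficient \<open>c l\<close> counts the first occurrences of \<open>f\<close> below the other
  children, \<open>l\<close> levels further down.
\<close>

locale branching_comparison =
  fixes S X :: "nat \<Rightarrow> real" and V :: "nat \<Rightarrow> 'k::finite \<Rightarrow> real"
    and E :: "'k \<Rightarrow> 'k \<Rightarrow> bool" and c :: "nat \<Rightarrow> real" and N p :: nat and R C D :: real
  assumes c_nonneg: "0 \<le> c l"
    and c_pos: "0 < (\<Sum>l\<le>N. c l)"
    and nonneg: "0 \<le> R" "0 \<le> C"
    and S_pos: "0 < S n"
    and S_mono: "mono S"
    and S_top: "filterlim S at_top sequentially"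
    and S_Suc: "N \<le> n \<Longrightarrow> S (Suc n) = R + S n + (\<Sum>l\<le>N. c l * S (n - l))"
    and X_Suc: "N \<le> n \<Longrightarrow> X (Suc n) \<le> C + X n + (\<Sum>l\<le>N. c l * X (n - l))"
    and V_Suc: "N \<le> n \<Longrightarrow> E i j \<Longrightarrow>
      V n j + (\<Sum>l\<le>N. c l * Min (range (V (n - l)))) \<le> V (Suc n) i"
    and V_le_X: "V n i \<le> X n"
    and X_le_V: "\<exists>i. X n \<le> V n i + D"
    and E_power: "p \<le> t \<Longrightarrow> (E ^^ t) i j"
begin

definition kappa :: real where "kappa = (\<Sum>l\<le>N. c l)"

text \<open>
  The additive constants in the recursions for \<open>S\<close> and \<open>X\<close> disappear after a shift: as the coefficients
  add up to \<open>1 + kappa\<close>, adding \<open>z / kappa\<close> to a sequence changes the right-hand side by \<open>z\<close> more than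
  the left-hand side.
\<close>

definition \<sigma> :: "nat \<Rightarrow> real" where "\<sigma> n = S n + R / kappa"

definition Y :: "nat \<Rightarrow> real" where "Y n = X n + C / kappa"

text \<open>
  A lower bound for the weight \<open>\<sigma> n / \<sigma> (n + 1)\<close> that the immediate predecessor has in the mean.
\<close>

definition \<delta> :: real where "\<delta> = 1 / (1 + kappa)"

lemma kappa_pos: "0 < kappa"
  using c_pos by (simp add: kappa_def)

lemma \<delta>_bounds: "0 < \<delta>" "\<delta> \<le> 1"
  using kappa_pos by (simp_all add: \<delta>_def)

lemma \<sigma>_pos: "0 < \<sigma> n"
  using S_pos[of n] nonneg kappa_pos by (simp add: \<sigma>_def add_pos_nonneg)

lemma \<sigma>_top: "filterlim \<sigma> at_top sequentially"
  unfolding \<sigma>_def using filterlim_tendsto_add_at_top[OF tendsto_const[of "R / kappa"] S_top]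
  by (simp add: add.commute)

lemma sum_weights_shift:
  "(\<Sum>l\<le>N. c l * (f (n - l) + z / kappa)) = (\<Sum>l\<le>N. c l * f (n - l)) + z"
proof -
  have "(\<Sum>l\<le>N. c l * (f (n - l) + z / kappa)) =
      (\<Sum>l\<le>N. c l * f (n - l)) + (\<Sum>l\<le>N. c l) * (z / kappa)"
    by (simp only: distrib_left sum.distrib sum_distrib_right)
  also have "(\<Sum>l\<le>N. c l) * (z / kappa) = z"
    using kappa_pos by (simp flip: kappa_def)
  finally show ?thesis .
qed

lemma \<sigma>_Suc: "N \<le> n \<Longrightarrow> \<sigma> (Suc n) = \<sigma> n + (\<Sum>l\<le>N. c l * \<sigma> (n - l))"
  unfolding \<sigma>_def sum_weights_shift using S_Suc[of n] by simp

lemma Y_Suc: "N \<le> n \<Longrightarrow> Y (Suc n) \<le> Y n + (\<Sum>l\<le>N. c l * Y (n - l))"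
  unfolding Y_def sum_weights_shift using X_Suc[of n] by simp

lemma \<sigma>_ratio: "N \<le> n \<Longrightarrow> \<delta> * \<sigma> (Suc n) \<le> \<sigma> n"
proof -
  assume "N \<le> n"
  have "(\<Sum>l\<le>N. c l * \<sigma> (n - l)) \<le> (\<Sum>l\<le>N. c l * \<sigma> n)"
    by (intro sum_mono mult_left_mono c_nonneg) (simp add: \<sigma>_def monoD[OF S_mono])
  then have "\<sigma> (Suc n) \<le> (1 + kappa) * \<sigma> n"
    using \<sigma>_Suc[OF \<open>N \<le> n\<close>] by (simp add: kappa_def algebra_simps flip: sum_distrib_right)
  then show ?thesis
    using kappa_pos by (simp add: \<delta>_def field_simps)
qed

text \<open>
  An upper bound \<open>b\<close> for the ratios in a window of length \<open>N\<close> is inherited by the mean of these ratios.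
  If the last ratio is smaller by \<open>e\<close>, then the mean is smaller by \<open>e\<close> times the weight of the last one.
\<close>

lemma upper_step:
  assumes "N \<le> n" "\<And>r. n - N \<le> r \<Longrightarrow> r \<le> n \<Longrightarrow> Y r \<le> b * \<sigma> r"
    and "Y n \<le> (b - e) * \<sigma> n" "0 \<le> e"
  shows "Y (Suc n) \<le> (b - \<delta> * e) * \<sigma> (Suc n)"
proof -
  have "(\<Sum>l\<le>N. c l * Y (n - l)) \<le> (\<Sum>l\<le>N. c l * (b * \<sigma> (n - l)))"
    using assms(2) by (intro sum_mono mult_left_mono c_nonneg) auto
  then have "Y (Suc n) \<le> (b - e) * \<sigma> n + b * (\<Sum>l\<le>N. c l * \<sigma> (n - l))"
    using Y_Suc[OF assms(1)] assms(3) by (simp add: sum_distrib_left mult_ac)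
  also have "\<dots> = b * \<sigma> (Suc n) - e * \<sigma> n"
    using \<sigma>_Suc[OF assms(1)] by (simp add: algebra_simps)
  also have "\<dots> \<le> b * \<sigma> (Suc n) - e * (\<delta> * \<sigma> (Suc n))"
    using mult_left_mono[OF \<sigma>_ratio[OF assms(1)] assms(4)] by simp
  finally show ?thesis by (simp add: algebra_simps)
qed

lemma upper_propagates:
  assumes "\<And>r. n \<le> r \<Longrightarrow> r \<le> n + N \<Longrightarrow> Y r \<le> b * \<sigma> r" "n \<le> r"
  shows "Y r \<le> b * \<sigma> r"
  using assms(2)
proof (induction r rule: less_induct)
  case (less r)
  show ?case
  proof (cases "r \<le> n + N")
    case False
    then obtain s where "r = Suc s" "n + N \<le> s"
      by (metis Suc_le_D not_less_eq_eq)
    then show ?thesis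
      using upper_step[of s b 0] less.IH by auto
  qed (use less assms in auto)
qed

text \<open>
  The counterpart for lower bounds. Only one good label \<open>j\<close> is needed at depth \<open>n\<close>: the
  improvement passes to all labels that have \<open>j\<close> as a successor.
\<close>

lemma lower_step:
  assumes "N \<le> n" "\<And>r i. n - N \<le> r \<Longrightarrow> r \<le> n \<Longrightarrow> a * \<sigma> r \<le> V r i"
    and "(a + e) * \<sigma> n \<le> V n j" "0 \<le> e" "E i j"
  shows "(a + \<delta> * e) * \<sigma> (Suc n) \<le> V (Suc n) i"
proof -
  have "(a + \<delta> * e) * \<sigma> (Suc n) = a * \<sigma> (Suc n) + e * (\<delta> * \<sigma> (Suc n))"
    by (simp add: algebra_simps)
  also have "\<dots> \<le> a * \<sigma> (Suc n) + e * \<sigma> n"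
    using mult_left_mono[OF \<sigma>_ratio[OF assms(1)] assms(4)] by simp
  also have "\<dots> = (a + e) * \<sigma> n + (\<Sum>l\<le>N. c l * (a * \<sigma> (n - l)))"
    using \<sigma>_Suc[OF assms(1)] by (simp add: algebra_simps sum_distrib_left)
  also have "\<dots> \<le> V n j + (\<Sum>l\<le>N. c l * Min (range (V (n - l))))"
    using assms(2,3) by (intro add_mono sum_mono mult_left_mono c_nonneg) auto
  also have "\<dots> \<le> V (Suc n) i"
    using V_Suc[OF assms(1,5)] .
  finally show ?thesis .
qed

lemma E_successor: "\<exists>j. E i j"
proof -
  have "(E ^^ Suc p) i i" by (rule E_power) simp
  then show ?thesis by (meson relpowp_Suc_D2)
qed

lemma lower_propagates:
  assumes "\<And>r i. n \<le> r \<Longrightarrow> r \<le> n + N \<Longrightarrow> a * \<sigma> r \<le> V r i" "n \<le> r"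
  shows "a * \<sigma> r \<le> V r i"
  using assms(2)
proof (induction r arbitrary: i rule: less_induct)
  case (less r)
  show ?case
  proof (cases "r \<le> n + N")
    case False
    then obtain s where "r = Suc s" "n + N \<le> s"
      by (metis Suc_le_D not_less_eq_eq)
    moreover obtain j where "E i j" using E_successor by blast
    ultimately show ?thesis
      using lower_step[of s a 0 j i] less.IH by auto
  qed (use less assms in auto)
qed

text \<open>
  One small ratio lowers the bound for all later ratios: the gain shrinks by the factor \<open>\<delta>\<close> at each of
  the next \<open>N\<close> steps, and once a whole window has gained \<open>\<delta> ^ N * e\<close>, the gain propagates.
\<close>

lemma upper_improves:
  assumes "\<And>r. n \<le> r \<Longrightarrow> Y r \<le> b * \<sigma> r" "n + N \<le> q" "Y q \<le> (b - e) * \<sigma> q" "0 \<le> e" "q \<le> r"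
  shows "Y r \<le> (b - \<delta> ^ N * e) * \<sigma> r"
proof (rule upper_propagates[OF _ \<open>q \<le> r\<close>])
  fix r assume r: "q \<le> r" "r \<le> q + N"
  have "Y (q + t) \<le> (b - \<delta> ^ t * e) * \<sigma> (q + t)" for t
  proof (induction t)
    case (Suc t)
    have "Y (Suc (q + t)) \<le> (b - \<delta> * (\<delta> ^ t * e)) * \<sigma> (Suc (q + t))"
      using Suc assms \<delta>_bounds by (intro upper_step) auto
    then show ?case by (simp add: mult.assoc)
  qed (use assms in simp)
  from this[of "r - q"] have "Y r \<le> (b - \<delta> ^ (r - q) * e) * \<sigma> r"
    using r by simp
  also have "\<dots> \<le> (b - \<delta> ^ N * e) * \<sigma> r"
    using r \<delta>_bounds assms(4) \<sigma>_pos[of r]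
    by (intro mult_right_mono diff_left_mono power_decreasing) auto
  finally show "Y r \<le> (b - \<delta> ^ N * e) * \<sigma> r" .
qed

text \<open>
  One large value at a single label raises the bound for all labels: after \<open>p\<close> steps every label has
  a walk to \<open>j\<close>, and \<open>N\<close> more steps fill a whole window.
\<close>

lemma lower_improves:
  assumes "\<And>r i. n \<le> r \<Longrightarrow> a * \<sigma> r \<le> V r i" "n + N \<le> q" "(a + e) * \<sigma> q \<le> V q j" "0 \<le> e"
    "q + p \<le> r"
  shows "(a + \<delta> ^ (p + N) * e) * \<sigma> r \<le> V r i"
proof (rule lower_propagates[OF _ \<open>q + p \<le> r\<close>])
  fix r i assume r: "q + p \<le> r" "r \<le> q + p + N"
  have "(E ^^ t) i j \<Longrightarrow> (a + \<delta> ^ t * e) * \<sigma> (q + t) \<le> V (q + t) i" for t i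
  proof (induction t arbitrary: i)
    case (Suc t)
    then obtain i' where "E i i'" "(E ^^ t) i' j"
      by (meson relpowp_Suc_D2)
    then have "(a + \<delta> * (\<delta> ^ t * e)) * \<sigma> (Suc (q + t)) \<le> V (Suc (q + t)) i"
      using Suc assms \<delta>_bounds by (intro lower_step) auto
    then show ?case by (simp add: mult.assoc)
  qed (use assms in simp)
  from this[of "r - q", OF E_power] have "(a + \<delta> ^ (r - q) * e) * \<sigma> r \<le> V r i"
    using r by simp
  moreover have "(a + \<delta> ^ (p + N) * e) * \<sigma> r \<le> (a + \<delta> ^ (r - q) * e) * \<sigma> r"
    using r \<delta>_bounds assms(4) \<sigma>_pos[of r]
    by (intro mult_right_mono add_left_mono power_decreasing) auto
  ultimately show "(a + \<delta> ^ (p + N) * e) * \<sigma> r \<le> V r i" by linarith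
qed

text \<open>
  The infimum of \<open>uppers\<close> is the upper limit of \<open>Y / \<sigma>\<close>, the supremum of \<open>lowers\<close> the lower limit
  of the minimum of \<open>V / \<sigma>\<close> over the labels.
\<close>

definition uppers :: "real set" where
  "uppers = {u. \<exists>n. \<forall>r\<ge>n. Y r \<le> u * \<sigma> r}"

definition lowers :: "real set" where
  "lowers = {l. \<exists>n. \<forall>r\<ge>n. \<forall>i. l * \<sigma> r \<le> V r i}"

lemma eventually_below_upper:
  assumes "u \<in> uppers" "u < v"
  shows "\<exists>n. \<forall>r\<ge>n. Y r \<le> v * \<sigma> r"
proof -
  obtain n where n: "\<forall>r\<ge>n. Y r \<le> u * \<sigma> r"
    using assms(1) by (auto simp: uppers_def)
  moreover have "u * \<sigma> r \<le> v * \<sigma> r" for r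
    using assms(2) \<sigma>_pos[of r] by simp
  ultimately show ?thesis by (meson order_trans)
qed

lemma eventually_above_lower:
  assumes "l \<in> lowers" "a < l"
  shows "\<exists>n. \<forall>r\<ge>n. \<forall>i. a * \<sigma> r \<le> V r i"
proof -
  obtain n where n: "\<forall>r\<ge>n. \<forall>i. l * \<sigma> r \<le> V r i"
    using assms(1) by (auto simp: lowers_def)
  moreover have "a * \<sigma> r \<le> l * \<sigma> r" for r
    using assms(2) \<sigma>_pos[of r] by simp
  ultimately show ?thesis by (meson order_trans)
qed

lemma uppers_nonempty: "uppers \<noteq> {}"
proof -
  define u where "u = Max ((\<lambda>r. Y r / \<sigma> r) ` {..N})"
  have "Y r \<le> u * \<sigma> r" if "r \<le> N" for r
  proof -
    have "Y r / \<sigma> r \<le> u" unfolding u_def using that by (intro Max_ge) auto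
    then show ?thesis using \<sigma>_pos[of r] by (simp add: field_simps)
  qed
  then have "Y r \<le> u * \<sigma> r" for r
    using upper_propagates[of 0 u r] by auto
  then show ?thesis by (auto simp: uppers_def)
qed

lemma lowers_nonempty: "lowers \<noteq> {}"
proof -
  define l where "l = Min ((\<lambda>(r, i). V r i / \<sigma> r) ` ({..N} \<times> UNIV))"
  have "l * \<sigma> r \<le> V r i" if "r \<le> N" for r i
  proof -
    have "l \<le> V r i / \<sigma> r"
      unfolding l_def using that by (intro Min_le) auto
    then show ?thesis using \<sigma>_pos[of r] by (simp add: field_simps)
  qed
  then have "l * \<sigma> r \<le> V r i" for r i
    using lower_propagates[of 0 l r] by auto
  then show ?thesis by (auto simp: lowers_def)
qed

lemma lower_le_upper:
  assumes "l \<in> lowers" "u \<in> uppers"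
  shows "l \<le> u"
proof -
  obtain n m where "\<forall>r\<ge>n. \<forall>i. l * \<sigma> r \<le> V r i" "\<forall>r\<ge>m. Y r \<le> u * \<sigma> r"
    using assms by (auto simp: lowers_def uppers_def)
  then have "l * \<sigma> (max n m) \<le> V (max n m) undefined" "Y (max n m) \<le> u * \<sigma> (max n m)"
    by auto
  moreover have "V (max n m) undefined \<le> Y (max n m)"
    using V_le_X[of "max n m" undefined] nonneg kappa_pos by (simp add: Y_def add_increasing2)
  ultimately have "l * \<sigma> (max n m) \<le> u * \<sigma> (max n m)" by linarith
  then show ?thesis using \<sigma>_pos by simp
qed

text \<open>
  At a late depth \<open>q\<close> the ratio \<open>Y q / \<sigma> q\<close> lies on one side of the midpoint between the two rates. Below
  it, \<open>upper_improves\<close> contradicts the choice of the upper rate. Above it, a label with a nearly maximal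
  count makes \<open>lower_improves\<close> contradict the choice of the lower rate.
\<close>

theorem upper_rate_eq_lower_rate: "Inf uppers = Sup lowers"
proof (rule antisym)
  have bdd: "bdd_below uppers" "bdd_above lowers"
    using uppers_nonempty lowers_nonempty lower_le_upper
    by (meson bdd_below.I bdd_above.I ex_in_conv)+
  show "Sup lowers \<le> Inf uppers"
    using uppers_nonempty lowers_nonempty lower_le_upper
    by (intro cSup_least cInf_greatest) auto
  show "Inf uppers \<le> Sup lowers"
  proof (rule ccontr)
    define U L where "U = Inf uppers" and "L = Sup lowers"
    define g where "g = (U - L) / 2"
    define \<theta> where "\<theta> = \<delta> ^ (p + N)"
    \<comment> \<open>Both improvements are at least \<open>\<theta> * g\<close>, more than the slack \<open>\<epsilon>\<close> in the bounds valid from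
      some depth on.\<close>
    define \<epsilon> where "\<epsilon> = \<theta> * g / 2"
    assume "\<not> Inf uppers \<le> Sup lowers"
    then have g: "0 < g" by (simp add: g_def U_def L_def)
    have \<theta>: "0 < \<theta>" "\<theta> \<le> \<delta> ^ N"
      using \<delta>_bounds by (auto simp: \<theta>_def intro!: power_decreasing)
    have \<epsilon>: "0 < \<epsilon>" "\<epsilon> < \<theta> * g" "\<epsilon> < \<delta> ^ N * g"
    proof -
      have "0 < \<theta> * g" "\<theta> * g \<le> \<delta> ^ N * g"
        using g \<theta> by (simp_all add: mult_right_mono)
      then show "0 < \<epsilon>" "\<epsilon> < \<theta> * g" "\<epsilon> < \<delta> ^ N * g"
        by (simp_all add: \<epsilon>_def)
    qed
    obtain u where "u \<in> uppers" "u < U + \<epsilon>"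
      using cInf_lessD[OF uppers_nonempty, of "U + \<epsilon>"] \<epsilon> by (auto simp: U_def)
    then obtain n1 where n1: "\<And>r. n1 \<le> r \<Longrightarrow> Y r \<le> (U + \<epsilon>) * \<sigma> r"
      using eventually_below_upper by blast
    obtain l where "l \<in> lowers" "L - \<epsilon> < l"
      using less_cSupE[OF _ lowers_nonempty, of "L - \<epsilon>"] \<epsilon> by (auto simp: L_def)
    then obtain n2 where n2: "\<And>r i. n2 \<le> r \<Longrightarrow> (L - \<epsilon>) * \<sigma> r \<le> V r i"
      using eventually_above_lower by blast
    obtain n3 where n3: "\<And>r. n3 \<le> r \<Longrightarrow> (D + C / kappa) / \<epsilon> \<le> \<sigma> r"
      using \<sigma>_top by (auto simp: filterlim_at_top eventually_sequentially)
    define q where "q = n1 + n2 + n3 + N"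
    show False
    proof (cases "Y q \<le> (U + \<epsilon> - (g + \<epsilon>)) * \<sigma> q")
      case True
      have "Y r \<le> (U + \<epsilon> - \<delta> ^ N * (g + \<epsilon>)) * \<sigma> r" if "q \<le> r" for r
        using True n1 that g \<epsilon> by (intro upper_improves[of n1]) (auto simp: q_def)
      then have "U + \<epsilon> - \<delta> ^ N * (g + \<epsilon>) \<in> uppers" by (auto simp: uppers_def)
      then have "U \<le> U + \<epsilon> - \<delta> ^ N * (g + \<epsilon>)"
        unfolding U_def using bdd by (intro cInf_lower)
      moreover have "0 \<le> \<delta> ^ N * \<epsilon>" using \<epsilon> \<delta>_bounds by simp
      ultimately show False using \<epsilon> by (simp add: algebra_simps)
    next
      case False
      obtain j where j: "X q \<le> V q j + D" using X_le_V by blast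
      have "D + C / kappa \<le> \<epsilon> * \<sigma> q"
        using n3[of q] \<epsilon> by (simp add: q_def field_simps)
      moreover have "U - g = L + g" by (simp add: g_def field_simps)
      ultimately have "(L - \<epsilon> + g) * \<sigma> q \<le> V q j"
        using False j by (simp add: Y_def algebra_simps)
      then have "(L - \<epsilon> + \<theta> * g) * \<sigma> r \<le> V r i" if "q + p \<le> r" for r i
        unfolding \<theta>_def using n2 that g by (intro lower_improves[of n2]) (auto simp: q_def)
      then have "L - \<epsilon> + \<theta> * g \<in> lowers" by (auto simp: lowers_def)
      then have "L - \<epsilon> + \<theta> * g \<le> L"
        unfolding L_def using bdd by (intro cSup_upper)
      then show False using \<epsilon> by simp
    qed
  qed
qed

text \<open>
  The conclusion is stated with an additive constant in place of a limit, since this form is stable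
  under gluing finitely many trees together.
\<close>

theorem common_rate:
  "\<exists>h. \<forall>\<epsilon>>0. \<exists>K. \<forall>n. X n \<le> (h + \<epsilon>) * S n + K \<and> (\<forall>i. (h - \<epsilon>) * S n \<le> V n i + K)"
proof (rule exI[of _ "Inf uppers"], intro allI impI)
  fix \<epsilon> :: real assume \<epsilon>: "0 < \<epsilon>"
  define h where "h = Inf uppers"
  obtain u where "u \<in> uppers" "u < h + \<epsilon>"
    using cInf_lessD[OF uppers_nonempty, of "h + \<epsilon>"] \<epsilon> by (auto simp: h_def)
  then obtain n1 where n1: "\<And>r. n1 \<le> r \<Longrightarrow> Y r \<le> (h + \<epsilon>) * \<sigma> r"
    using eventually_below_upper by blast
  obtain l where "l \<in> lowers" "h - \<epsilon> < l"
    using less_cSupE[OF _ lowers_nonempty, of "h - \<epsilon>"] \<epsilon>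
    by (auto simp: h_def upper_rate_eq_lower_rate)
  then obtain n2 where n2: "\<And>r i. n2 \<le> r \<Longrightarrow> (h - \<epsilon>) * \<sigma> r \<le> V r i"
    using eventually_above_lower by blast
  obtain K1 where K1: "\<And>r. Y r \<le> (h + \<epsilon>) * \<sigma> r + K1"
    using eventually_imp_affine_bound[of n1 Y "\<lambda>r. (h + \<epsilon>) * \<sigma> r"] n1 by auto
  obtain K2 where K2: "\<And>r. (h - \<epsilon>) * \<sigma> r \<le> Min (range (V r)) + K2"
    using eventually_imp_affine_bound[of n2 "\<lambda>r. (h - \<epsilon>) * \<sigma> r" "\<lambda>r. Min (range (V r))"] n2
    by auto
  define z1 z2 where "z1 = (h + \<epsilon>) * (R / kappa)" and "z2 = (h - \<epsilon>) * (R / kappa)"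
  let ?K = "\<bar>K1\<bar> + \<bar>K2\<bar> + \<bar>z1\<bar> + \<bar>z2\<bar>"
  have "X n \<le> (h + \<epsilon>) * S n + ?K" for n
  proof -
    have "X n \<le> Y n" using nonneg kappa_pos by (simp add: Y_def)
    then show ?thesis using K1[of n] unfolding \<sigma>_def distrib_left z1_def[symmetric] z2_def[symmetric] by linarith
  qed
  moreover have "(h - \<epsilon>) * S n \<le> V n i + ?K" for n i
  proof -
    have "Min (range (V n)) \<le> V n i" by simp
    then show ?thesis using K2[of n] unfolding \<sigma>_def distrib_left z1_def[symmetric] z2_def[symmetric] by linarith
  qed
  ultimately show "\<exists>K. \<forall>n. X n \<le> (Inf uppers + \<epsilon>) * S n + K \<and>
      (\<forall>i. (Inf uppers - \<epsilon>) * S n \<le> V n i + K)"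
    unfolding h_def by blast
qed

end

section \<open>Labelings of finite trees\<close>

definition is_tree :: "'d list set \<Rightarrow> bool" where
  "is_tree F \<longleftrightarrow> finite F \<and> [] \<in> F \<and> (\<forall>u v. u @ v \<in> F \<longrightarrow> u \<in> F)"

definition heads :: "'d list set \<Rightarrow> 'd set" where
  "heads F = {g. [g] \<in> F}"

text \<open>
  For \<open>g \<notin> heads F\<close> and \<open>F\<close> a tree, \<open>subtree g F\<close> is empty and so not a tree.
\<close>

definition subtree :: "'d \<Rightarrow> 'd list set \<Rightarrow> 'd list set" where
  "subtree g F = {w. g # w \<in> F}"

definition homs :: "('k \<Rightarrow> 'k \<Rightarrow> bool) \<Rightarrow> 'd list set \<Rightarrow> 'k \<Rightarrow> ('d list \<Rightarrow> 'k) set" where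
  "homs E F i = {t \<in> F \<rightarrow>\<^sub>E UNIV. t [] = i \<and> (\<forall>w g. w @ [g] \<in> F \<longrightarrow> E (t w) (t (w @ [g])))}"

lemma is_treeD:
  assumes "is_tree F"
  shows "finite F" "[] \<in> F" "u @ v \<in> F \<Longrightarrow> u \<in> F" "g # w \<in> F \<Longrightarrow> g \<in> heads F"
proof -
  show "finite F" "[] \<in> F" "u @ v \<in> F \<Longrightarrow> u \<in> F"
    using assms by (auto simp: is_tree_def)
  have "[g] @ w \<in> F \<Longrightarrow> [g] \<in> F"
    using assms unfolding is_tree_def by blast
  then show "g # w \<in> F \<Longrightarrow> g \<in> heads F"
    by (simp add: heads_def)
qed

lemma finite_heads: "is_tree F \<Longrightarrow> finite (heads F)"
  using finite_vimageI[of F "\<lambda>g. [g]"] by (auto simp: heads_def vimage_def inj_def dest: is_treeD)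

lemma is_tree_subtree:
  assumes "is_tree F" "g \<in> heads F"
  shows "is_tree (subtree g F)"
proof -
  have "finite (subtree g F)"
    using finite_vimageI[OF is_treeD(1)[OF assms(1)], of "(#) g"]
    by (auto simp: subtree_def vimage_def)
  moreover have "u @ v \<in> subtree g F \<Longrightarrow> u \<in> subtree g F" for u v
    using is_treeD(3)[OF assms(1), of "g # u" v] by (simp add: subtree_def)
  ultimately show ?thesis
    using assms(2) unfolding is_tree_def by (auto simp: subtree_def heads_def)
qed

lemma card_tree:
  assumes "is_tree F"
  shows "card F = 1 + (\<Sum>g\<in>heads F. card (subtree g F))"
proof -
  have F: "F = insert [] (\<Union>g\<in>heads F. (#) g ` subtree g F)"
  proof (intro set_eqI iffI)
    fix w assume "w \<in> F"
    then show "w \<in> insert [] (\<Union>g\<in>heads F. (#) g ` subtree g F)"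
      using is_treeD(4)[OF assms] by (cases w) (auto simp: subtree_def)
  qed (use is_treeD(2)[OF assms] in \<open>auto simp: subtree_def\<close>)
  have fin: "finite (subtree g F)" if "g \<in> heads F" for g
    using is_treeD(1)[OF is_tree_subtree[OF assms that]] .
  have "card F = Suc (card (\<Union>g\<in>heads F. (#) g ` subtree g F))"
    by (subst F, subst card_insert_disjoint) (auto simp: finite_heads[OF assms] fin)
  also have "card (\<Union>g\<in>heads F. (#) g ` subtree g F) = (\<Sum>g\<in>heads F. card ((#) g ` subtree g F))"
    by (intro card_UN_disjoint) (auto simp: finite_heads[OF assms] fin)
  also have "\<dots> = (\<Sum>g\<in>heads F. card (subtree g F))"
    by (intro sum.cong refl card_image) simp
  finally show ?thesis by simp
qed

lemma finite_homs: "finite F \<Longrightarrow> finite (homs E F (i :: 'k :: finite))"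
  unfolding homs_def by (rule finite_subset[of _ "F \<rightarrow>\<^sub>E UNIV"]) (auto intro: finite_PiE)

lemma homs_disjoint: "i \<noteq> j \<Longrightarrow> homs E F i \<inter> homs E F j = {}"
  by (auto simp: homs_def)

text \<open>
  Given the root label, a labeling is a free choice of labelings of the subtrees whose root
  labels succeed it.
\<close>

lemma card_homs:
  fixes E :: "'k::finite \<Rightarrow> 'k \<Rightarrow> bool"
  assumes "is_tree F"
  shows "card (homs E F i) = (\<Prod>g\<in>heads F. \<Sum>j | E i j. card (homs E (subtree g F) j))"
proof -
  define H where "H g = (\<Union>j\<in>{j. E i j}. homs E (subtree g F) j)" for g
  define split where "split t = (\<lambda>g\<in>heads F. \<lambda>w\<in>subtree g F. t (g # w))" for t :: "'a list \<Rightarrow> 'k"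
  define glue where "glue s = (\<lambda>w\<in>F. case w of [] \<Rightarrow> i | g # w' \<Rightarrow> s g w')"
    for s :: "'a \<Rightarrow> 'a list \<Rightarrow> 'k"
  have "bij_betw split (homs E F i) (PiE (heads F) H)"
  proof (rule bij_betw_byWitness[where f' = glue])
    show "\<forall>t\<in>homs E F i. glue (split t) = t"
    proof
      fix t assume t: "t \<in> homs E F i"
      show "glue (split t) = t"
      proof
        fix w
        show "glue (split t) w = t w"
        proof (cases "w \<in> F")
          case True
          then show ?thesis
            using t is_treeD(4)[OF assms]
            by (cases w) (auto simp: glue_def split_def homs_def subtree_def)
        next
          case False
          then show ?thesis
            using t by (auto simp: glue_def homs_def PiE_def extensional_def)
        qed
      qed
    qed
    show "\<forall>s\<in>PiE (heads F) H. split (glue s) = s"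
    proof
      fix s assume s: "s \<in> PiE (heads F) H"
      show "split (glue s) = s"
      proof
        fix g
        show "split (glue s) g = s g"
        proof (cases "g \<in> heads F")
          case True
          then have "s g \<in> H g"
            using s by (auto dest: PiE_mem)
          then have "s g \<in> extensional (subtree g F)"
            by (auto simp: H_def homs_def PiE_def)
          with True show ?thesis
            by (auto simp: split_def glue_def subtree_def extensional_def)
        next
          case False
          then show ?thesis using s by (auto simp: split_def PiE_def extensional_def)
        qed
      qed
    qed
    show "split ` homs E F i \<subseteq> PiE (heads F) H"
    proof (intro image_subsetI PiE_I)
      fix t g assume t: "t \<in> homs E F i" and g: "g \<in> heads F"
      have edges: "E (t w) (t (w @ [h]))" if "w @ [h] \<in> F" for w h
        using t that by (auto simp: homs_def)
      have "split t g \<in> homs E (subtree g F) (t [g])"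
        unfolding homs_def
      proof (intro CollectI conjI allI impI)
        show "split t g \<in> subtree g F \<rightarrow>\<^sub>E UNIV"
          using g by (auto simp: split_def)
        show "split t g [] = t [g]"
          using g by (auto simp: split_def subtree_def heads_def)
        fix w h assume w: "w @ [h] \<in> subtree g F"
        then have "w \<in> subtree g F"
          using is_treeD(3)[OF is_tree_subtree[OF assms g]] by blast
        then show "E (split t g w) (split t g (w @ [h]))"
          using g w edges[of "g # w" h] by (simp add: split_def subtree_def)
      qed
      moreover have "E i (t [g])"
        using edges[of "[]" g] t g by (simp add: homs_def heads_def)
      ultimately show "split t g \<in> H g"
        by (auto simp: H_def)
    qed (simp add: split_def)
    show "glue ` PiE (heads F) H \<subseteq> homs E F i"
    proof (intro image_subsetI)
      fix s assume s: "s \<in> PiE (heads F) H"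
      show "glue s \<in> homs E F i"
        unfolding homs_def
      proof (intro CollectI conjI allI impI)
        show "glue s \<in> F \<rightarrow>\<^sub>E UNIV" by (auto simp: glue_def)
        show "glue s [] = i" using is_treeD(2)[OF assms] by (simp add: glue_def)
        fix w h assume w: "w @ [h] \<in> F"
        then have "w \<in> F" using is_treeD(3)[OF assms] by blast
        show "E (glue s w) (glue s (w @ [h]))"
        proof (cases w)
          case Nil
          then have "h \<in> heads F" using w by (simp add: heads_def)
          then have "s h \<in> H h" using s by (auto dest: PiE_mem)
          then show ?thesis using w Nil \<open>w \<in> F\<close> by (auto simp: glue_def H_def homs_def)
        next
          case (Cons g v)
          then have "g \<in> heads F" using w is_treeD(4)[OF assms] by auto
          then have "s g \<in> H g" using s by (auto dest: PiE_mem)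
          then show ?thesis
            using w Cons \<open>w \<in> F\<close> by (auto simp: glue_def H_def homs_def subtree_def)
        qed
      qed
    qed
  qed
  then have "card (homs E F i) = card (PiE (heads F) H)"
    by (rule bij_betw_same_card)
  also have "\<dots> = (\<Prod>g\<in>heads F. card (H g))"
    by (rule card_PiE[OF finite_heads[OF assms]])
  also have "\<dots> = (\<Prod>g\<in>heads F. \<Sum>j | E i j. card (homs E (subtree g F) j))"
  proof (intro prod.cong refl)
    fix g assume "g \<in> heads F"
    then have "finite (subtree g F)"
      using is_treeD(1)[OF is_tree_subtree[OF assms]] by blast
    then show "card (H g) = (\<Sum>j | E i j. card (homs E (subtree g F) j))"
      unfolding H_def by (intro card_UN_disjoint) (auto intro: finite_homs simp: homs_disjoint)
  qed
  finally show ?thesis .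
qed

locale serial_graph =
  fixes E :: "'k::finite \<Rightarrow> 'k \<Rightarrow> bool"
  assumes serial: "\<exists>j. E i j"
begin

definition next_label :: "'k \<Rightarrow> 'k" where "next_label i = (SOME j. E i j)"

lemma next_label: "E i (next_label i)"
  unfolding next_label_def by (rule someI_ex[OF serial])

definition log_count :: "'d list set \<Rightarrow> 'k \<Rightarrow> real" where
  "log_count F i = ln (real (card (homs E F i)))"

definition total :: "'d list set \<Rightarrow> nat" where
  "total F = (\<Sum>i\<in>UNIV. card (homs E F i))"

definition log_total :: "'d list set \<Rightarrow> real" where
  "log_total F = ln (real (total F))"

lemma card_homs_pos:
  assumes "is_tree F"
  shows "0 < card (homs E F i)"
proof -
  have "restrict (\<lambda>w. (next_label ^^ length w) i) F \<in> homs E F i"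
    using is_treeD[OF assms] by (auto simp: homs_def next_label)
  then show ?thesis
    using finite_homs[OF is_treeD(1)[OF assms]] by (auto simp: card_gt_0_iff)
qed

lemma total_pos: "is_tree F \<Longrightarrow> 0 < total F"
  unfolding total_def by (intro sum_pos) (auto simp: card_homs_pos)

lemma log_count_le_log_total: "is_tree F \<Longrightarrow> log_count F i \<le> log_total F"
proof -
  assume F: "is_tree F"
  have "card (homs E F i) \<le> total F"
    unfolding total_def by (rule member_le_sum) auto
  then show ?thesis
    unfolding log_count_def log_total_def using card_homs_pos[OF F, of i] total_pos[OF F]
    by (subst ln_le_cancel_iff) auto
qed

lemma log_total_le_log_count:
  assumes "is_tree F"
  shows "\<exists>i. log_total F \<le> log_count F i + ln (real CARD('k))"
proof -
  define x where "x i = card (homs E F i)" for i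
  have "Max (range x) \<in> range x" by (intro Max_in) auto
  then obtain i where "x i = Max (range x)" by (metis rangeE)
  then have "x j \<le> x i" for j by simp
  then have "total F \<le> of_nat CARD('k) * x i"
    unfolding total_def x_def by (intro sum_bounded_above) simp
  then have "real (total F) \<le> real (CARD('k) * x i)"
    unfolding of_nat_le_iff by simp
  moreover have "0 < x i"
    using card_homs_pos[OF assms] by (simp add: x_def)
  ultimately have "ln (real (total F)) \<le> ln (real (CARD('k) * x i))"
    using total_pos[OF assms] by (subst ln_le_cancel_iff) auto
  then show ?thesis
    using \<open>0 < x i\<close> unfolding log_total_def log_count_def x_def
    by (intro exI[of _ i]) (simp add: ln_mult)
qed

lemma log_total_subtrees:
  assumes "is_tree F"
  shows "log_total F \<le> ln (real CARD('k)) + (\<Sum>g\<in>heads F. log_total (subtree g F))"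
proof -
  define T where "T g = total (subtree g F)" for g
  have T: "0 < T g" if "g \<in> heads F" for g
    unfolding T_def using total_pos[OF is_tree_subtree[OF assms that]] .
  have "total F \<le> (\<Sum>i\<in>(UNIV :: 'k set). \<Prod>g\<in>heads F. T g)"
    unfolding card_homs[OF assms] T_def total_def by (intro sum_mono prod_mono conjI sum_mono2) auto
  also have "\<dots> = CARD('k) * (\<Prod>g\<in>heads F. T g)"
    by simp
  finally have "real (total F) \<le> real CARD('k) * (\<Prod>g\<in>heads F. real (T g))"
    by (metis of_nat_le_iff of_nat_mult of_nat_prod)
  then have "log_total F \<le> ln (real CARD('k) * (\<Prod>g\<in>heads F. real (T g)))"
    unfolding log_total_def using total_pos[OF assms] by (subst ln_le_cancel_iff) (auto intro!: mult_pos_pos prod_pos T)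
  also have "\<dots> = ln (real CARD('k)) + (\<Sum>g\<in>heads F. ln (real (T g)))"
    using T by (subst ln_mult_pos) (auto intro!: prod_pos simp: ln_prod finite_heads[OF assms])
  finally show ?thesis by (simp add: log_total_def T_def)
qed

lemma log_count_subtrees:
  assumes "is_tree F" "\<And>g. g \<in> heads F \<Longrightarrow> E i (j g)"
  shows "(\<Sum>g\<in>heads F. log_count (subtree g F) (j g)) \<le> log_count F i"
proof -
  define x where "x g = card (homs E (subtree g F) (j g))" for g
  have x: "0 < x g" if "g \<in> heads F" for g
    unfolding x_def by (rule card_homs_pos[OF is_tree_subtree[OF assms(1) that]])
  have "(\<Prod>g\<in>heads F. x g) \<le> card (homs E F i)"
    unfolding card_homs[OF assms(1)] x_def
    using assms(2) by (intro prod_mono conjI member_le_sum) auto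
  then have "(\<Prod>g\<in>heads F. real (x g)) \<le> real (card (homs E F i))"
    by (metis of_nat_le_iff of_nat_prod)
  then have "ln (\<Prod>g\<in>heads F. real (x g)) \<le> log_count F i"
    unfolding log_count_def using x card_homs_pos[OF assms(1), of i]
    by (subst ln_le_cancel_iff) (auto intro!: prod_pos)
  also have "ln (\<Prod>g\<in>heads F. real (x g)) = (\<Sum>g\<in>heads F. log_count (subtree g F) (j g))"
    using x by (subst ln_prod) (auto simp: finite_heads[OF assms(1)] log_count_def x_def)
  finally show ?thesis .
qed

definition log_min :: "'d list set \<Rightarrow> real" where
  "log_min F = Min (range (log_count F))"

lemma log_min_le: "log_min F \<le> log_count F i"
  by (simp add: log_min_def)

lemma log_min_subtrees:
  assumes "is_tree F"
  shows "(\<Sum>g\<in>heads F. log_min (subtree g F)) \<le> log_min F"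
proof -
  have "(\<Sum>g\<in>heads F. log_min (subtree g F)) \<le> log_count F i" for i
  proof -
    have "(\<Sum>g\<in>heads F. log_min (subtree g F)) \<le>
        (\<Sum>g\<in>heads F. log_count (subtree g F) (next_label i))"
      by (intro sum_mono log_min_le)
    also have "\<dots> \<le> log_count F i"
      by (intro log_count_subtrees assms next_label)
    finally show ?thesis .
  qed
  then show ?thesis by (simp add: log_min_def)
qed

text \<open>
  The label of one child can be prescribed while the others still contribute their minimum. Iterated
  along \<open>f f \<dots> f\<close> this realizes a walk in \<open>E\<close>.
\<close>

lemma log_count_subtrees_distinguished:
  assumes "is_tree F" "f \<in> heads F" "E i j"
  shows "log_count (subtree f F) j + (\<Sum>g\<in>heads F - {f}. log_min (subtree g F)) \<le> log_count F i"
proof -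
  have "(\<Sum>g\<in>heads F - {f}. log_min (subtree g F)) \<le>
      (\<Sum>g\<in>heads F - {f}. log_count (subtree g F) (if g = f then j else next_label i))"
    by (intro sum_mono log_min_le)
  then have "log_count (subtree f F) j + (\<Sum>g\<in>heads F - {f}. log_min (subtree g F)) \<le>
      (\<Sum>g\<in>heads F. log_count (subtree g F) (if g = f then j else next_label i))"
    using assms(2) by (simp add: sum.remove[OF finite_heads[OF assms(1)]])
  also have "\<dots> \<le> log_count F i"
    using assms by (intro log_count_subtrees) (auto simp: next_label)
  finally show ?thesis .
qed

end

section \<open>Alphabets with a recurrent full letter\<close>

text \<open>
  The relation \<open>R\<close> says which letter may follow which. Both the existence of a full row
  and the bound \<open>N\<close> on words that avoid its letter come from a complete prefix set.
\<close>

locale recurrent_alphabet =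
  fixes R :: "'d::finite \<Rightarrow> 'd \<Rightarrow> bool" and f :: 'd and N :: nat
  assumes full: "R f g"
    and recurrent: "successively R w \<Longrightarrow> length w = N \<Longrightarrow> f \<in> set w"
begin

text \<open>
  The part of depth \<open>n\<close> of the tree that hangs below a vertex with last letter \<open>g\<close>. As \<open>f\<close> may be
  followed by every letter, \<open>limb f n\<close> is the ball around the root.
\<close>

definition limb :: "'d \<Rightarrow> nat \<Rightarrow> 'd list set" where
  "limb g n = {w. successively R (g # w) \<and> length w \<le> n}"

lemma successively_full: "successively R (f # w) \<longleftrightarrow> successively R w"
  using full by (cases w) auto

lemma N_pos: "0 < N"
  using recurrent[of "[]"] by (cases N) auto

lemma is_tree_limb: "is_tree (limb g n)"
proof -
  have "finite {w :: 'd list. set w \<subseteq> UNIV \<and> length w \<le> n}"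
    by (intro finite_lists_length_le) simp
  then have "finite (limb g n)"
    by (rule finite_subset[rotated]) (auto simp: limb_def)
  moreover have "u @ v \<in> limb g n \<Longrightarrow> u \<in> limb g n" for u v
    using successively_append_iff[of R "g # u" v] by (auto simp: limb_def)
  ultimately show ?thesis unfolding is_tree_def by (auto simp: limb_def)
qed

lemma heads_limb: "heads (limb g (Suc n)) = {h. R g h}"
  by (auto simp: heads_def limb_def)

lemma subtree_limb: "R g h \<Longrightarrow> subtree h (limb g (Suc n)) = limb h n"
  by (auto simp: subtree_def limb_def)

lemma limb_mono: "m \<le> n \<Longrightarrow> limb g m \<subseteq> limb g n"
  by (auto simp: limb_def)

lemma card_limb_ge: "R g f \<Longrightarrow> Suc n \<le> card (limb g n)"
proof -
  assume "R g f"
  have "successively R (replicate i f)" for i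
    by (induction i) (auto simp: successively_full)
  then have "successively R (g # replicate i f)" for i
    using \<open>R g f\<close> by (metis length_0_conv length_replicate list.sel(1) hd_replicate successively_Cons)
  then have "(\<lambda>i. replicate i f) ` {..n} \<subseteq> limb g n"
    by (auto simp: limb_def)
  then have "card ((\<lambda>i. replicate i f) ` {..n}) \<le> card (limb g n)"
    by (rule card_mono[OF is_treeD(1)[OF is_tree_limb]])
  moreover have "inj_on (\<lambda>i. replicate i f) {..n}"
    by (rule inj_onI) (metis length_replicate)
  ultimately show ?thesis by (simp add: card_image)
qed

lemma card_limb_at_top: "filterlim (\<lambda>n. real (card (limb f n))) at_top sequentially"
proof (rule filterlim_at_top_mono[OF filterlim_real_sequentially], rule always_eventually, rule allI)
  fix n show "real n \<le> real (card (limb f n))"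
    using card_limb_ge[of f n, OF full] by simp
qed

text \<open>
  \<open>passages l g\<close> is the number of words of length \<open>l\<close> that may follow \<open>g\<close> and contain \<open>f\<close> as their last
  letter only. \<open>excursion_size T g\<close> is the number of words of length less than \<open>T\<close> that
  may follow \<open>g\<close> and avoid \<open>f\<close>.
\<close>

primrec passages :: "nat \<Rightarrow> 'd \<Rightarrow> real" where
  "passages 0 g = 0"
| "passages (Suc l) g = (\<Sum>h | R g h. if h = f then of_bool (l = 0) else passages l h)"

primrec excursion_size :: "nat \<Rightarrow> 'd \<Rightarrow> real" where
  "excursion_size 0 g = 0"
| "excursion_size (Suc T) g = 1 + (\<Sum>h | R g h. if h = f then 0 else excursion_size T h)"

lemma passages_nonneg: "0 \<le> passages l g"
  by (induction l arbitrary: g) (auto intro!: sum_nonneg)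

lemma excursion_size_nonneg: "0 \<le> excursion_size T g"
  by (induction T arbitrary: g) (auto intro!: sum_nonneg add_nonneg_nonneg)

text \<open>
  Unfolding the one-step inequality at every letter other than \<open>f\<close> stops after \<open>T\<close> steps, because no
  word of length \<open>T\<close> after \<open>g\<close> avoids \<open>f\<close>. Each unfolded vertex costs \<open>b\<close>.
\<close>

lemma first_passage_general:
  fixes q :: "'d \<Rightarrow> nat \<Rightarrow> real"
  assumes q: "\<And>g n. q g (Suc n) \<le> b + (\<Sum>h | R g h. q h n)"
    and "\<And>w. successively R (g # w) \<Longrightarrow> length w = T \<Longrightarrow> f \<in> set w" "T \<le> n"
  shows "q g n \<le> b * excursion_size T g + (\<Sum>l\<le>T. passages l g * q f (n - l))"
  using assms(2,3)
proof (induction T arbitrary: g n)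
  case 0
  then show ?case using "0.prems"(1)[of "[]"] by simp
next
  case (Suc T)
  obtain n' where n: "n = Suc n'" "T \<le> n'" using Suc.prems(2) by (cases n) auto
  have "q h n' \<le> (if h = f then q f n'
      else b * excursion_size T h + (\<Sum>l\<le>T. passages l h * q f (n' - l)))" if "R g h" for h
  proof (cases "h = f")
    case False
    have "f \<in> set w" if "successively R (h # w)" "length w = T" for w
      using Suc.prems(1)[of "h # w"] that \<open>R g h\<close> False by auto
    then show ?thesis using Suc.IH[of h n'] n False by auto
  qed simp
  then have "q g n \<le> b + (\<Sum>h | R g h. if h = f then q f n'
      else b * excursion_size T h + (\<Sum>l\<le>T. passages l h * q f (n' - l)))"
    unfolding n by (intro order_trans[OF q] add_left_mono sum_mono) auto
  also have "\<dots> = b + (\<Sum>h | R g h. b * (if h = f then 0 else excursion_size T h) +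
      (\<Sum>l\<le>T. (if h = f then of_bool (l = 0) else passages l h) * q f (n' - l)))"
  proof (intro arg_cong2[where f = "(+)"] sum.cong refl)
    fix h
    have "(\<Sum>l\<le>T. of_bool (l = 0) * q f (n' - l)) = q f n'"
      by (subst sum.remove[of _ 0]) auto
    then show "(if h = f then q f n'
        else b * excursion_size T h + (\<Sum>l\<le>T. passages l h * q f (n' - l))) =
      b * (if h = f then 0 else excursion_size T h) +
      (\<Sum>l\<le>T. (if h = f then of_bool (l = 0) else passages l h) * q f (n' - l))"
      by (cases "h = f") (simp_all only: if_True if_False mult_zero_right add_0 simp_thms)
  qed
  also have "\<dots> = b * excursion_size (Suc T) g + (\<Sum>l\<le>T. passages (Suc l) g * q f (n' - l))"
    unfolding sum.distrib passages.simps sum_distrib_right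
    by (subst sum.swap) (simp add: distrib_left sum_distrib_left)
  also have "(\<Sum>l\<le>T. passages (Suc l) g * q f (n' - l)) =
      (\<Sum>l\<le>Suc T. passages l g * q f (n - l))"
    by (simp only: sum.atMost_Suc_shift n diff_Suc_Suc) simp
  finally show ?case .
qed

lemma first_passage:
  fixes q :: "'d \<Rightarrow> nat \<Rightarrow> real"
  assumes "\<And>g n. q g (Suc n) \<le> b + (\<Sum>h | R g h. q h n)" "N \<le> n"
  shows "q g n \<le> b * excursion_size N g + (\<Sum>l\<le>N. passages l g * q f (n - l))"
proof (rule first_passage_general[where q = q, OF assms(1) _ assms(2)])
  fix w assume "successively R (g # w)" "length w = N"
  then show "f \<in> set w" by (intro recurrent) (auto simp: successively_Cons)
qed

text \<open>
  Every limb is a bounded piece glued to boundedly many copies of balls, so a bound at \<open>f\<close>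
  suffices.
\<close>

lemma bounded_at_all_letters:
  fixes q :: "'d \<Rightarrow> nat \<Rightarrow> real"
  assumes "\<And>g n. q g (Suc n) \<le> b + (\<Sum>h | R g h. q h n)" "\<And>n. q f n \<le> K"
  shows "\<exists>K'\<ge>0. \<forall>g n. q g n \<le> K'"
proof -
  define B where "B g = \<bar>b * excursion_size N g\<bar> + (\<Sum>l\<le>N. passages l g * \<bar>K\<bar>) +
    (\<Sum>n<N. \<bar>q g n\<bar>)" for g
  have nonneg: "0 \<le> (\<Sum>l\<le>N. passages l g * \<bar>K\<bar>)" "0 \<le> (\<Sum>n<N. \<bar>q g n\<bar>)" for g
    by (auto intro!: sum_nonneg mult_nonneg_nonneg passages_nonneg)
  then have B: "0 \<le> B g" for g
    unfolding B_def by (intro add_nonneg_nonneg) auto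
  have "q g n \<le> B g" for g n
  proof (cases "n < N")
    case True
    then have "\<bar>q g n\<bar> \<le> (\<Sum>n<N. \<bar>q g n\<bar>)" by (intro member_le_sum) auto
    then show ?thesis using nonneg[of g] unfolding B_def by linarith
  next
    case False
    have "q f m \<le> \<bar>K\<bar>" for m using assms(2)[of m] by linarith
    then have "(\<Sum>l\<le>N. passages l g * q f (n - l)) \<le> (\<Sum>l\<le>N. passages l g * \<bar>K\<bar>)"
      by (intro sum_mono mult_left_mono passages_nonneg)
    moreover have "q g n \<le> b * excursion_size N g + (\<Sum>l\<le>N. passages l g * q f (n - l))"
      using False by (intro first_passage assms(1)) simp
    ultimately show ?thesis
      using nonneg[of g] unfolding B_def by linarith
  qed
  moreover have "B g \<le> (\<Sum>g\<in>UNIV. B g)" for g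
    using B by (intro member_le_sum) auto
  ultimately have "\<forall>g n. q g n \<le> (\<Sum>g\<in>UNIV. B g)" by (meson order_trans)
  then show ?thesis using B by (intro exI[of _ "\<Sum>g\<in>UNIV. B g"]) (auto intro: sum_nonneg)
qed

end

text \<open>
  The common form of the estimates for the size, its negative, the logarithm of the number
  of labelings and the negative of its minimum over the root labels. Also
  \<open>log_total F - z * card F\<close> and \<open>z * card F - log_min F\<close> are of this form, which turns a comparison
  of entropies into a bound for one function.
\<close>

definition subadditive_on_trees :: "('d list set \<Rightarrow> real) \<Rightarrow> real \<Rightarrow> bool" where
  "subadditive_on_trees q b \<longleftrightarrow>
     (\<forall>F. is_tree F \<longrightarrow> q F \<le> b + (\<Sum>g\<in>heads F. q (subtree g F)))"

lemma (in recurrent_alphabet) subadditive_limb: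
  assumes "subadditive_on_trees q b"
  shows "q (limb g (Suc n)) \<le> b + (\<Sum>h | R g h. q (limb h n))"
proof -
  have "q (limb g (Suc n)) \<le> b + (\<Sum>h | R g h. q (subtree h (limb g (Suc n))))"
    using assms is_tree_limb[of g "Suc n"] heads_limb[of g n]
    unfolding subadditive_on_trees_def by metis
  also have "(\<Sum>h | R g h. q (subtree h (limb g (Suc n)))) = (\<Sum>h | R g h. q (limb h n))"
    by (rule sum.cong) (auto simp: subtree_limb)
  finally show ?thesis .
qed

section \<open>The entropy of balls\<close>

locale hom_entropy = recurrent_alphabet R f N + serial_graph E
  for R :: "'d::finite \<Rightarrow> 'd \<Rightarrow> bool" and f :: 'd and N :: nat
  and E :: "'k::finite \<Rightarrow> 'k \<Rightarrow> bool" +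
  fixes p :: nat
  assumes primitive: "(E ^^ p) i j"
begin

lemma primitive_ge: "p \<le> t \<Longrightarrow> (E ^^ t) i j"
proof (induction t arbitrary: i rule: dec_induct)
  case (step t)
  then show ?case using serial relpowp_Suc_I2 by metis
qed (rule primitive)

lemma subadditive_log_total: "subadditive_on_trees log_total (ln (real CARD('k)))"
  using log_total_subtrees by (auto simp: subadditive_on_trees_def)

lemma subadditive_log_min: "subadditive_on_trees (\<lambda>F. - log_min F) 0"
  using log_min_subtrees by (auto simp: subadditive_on_trees_def sum_negf)

lemma subadditive_card:
  "subadditive_on_trees (\<lambda>F. real (card F)) 1" "subadditive_on_trees (\<lambda>F. - real (card F)) (-1)"
  by (auto simp: subadditive_on_trees_def sum_negf card_tree[where F = F for F])

text \<open>
  Cutting at the first occurrences of \<open>f\<close> puts the balls into the setting of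
  \<open>branching_comparison\<close>. The letter \<open>g\<close> provides a passage to \<open>f\<close> of length two and so makes the sum
  of the coefficients positive.
\<close>

lemma common_rate_limb:
  assumes "g \<noteq> f" "R g f"
  shows "\<exists>h. \<forall>\<epsilon>>0. \<exists>K. \<forall>n. log_total (limb f n) \<le> (h + \<epsilon>) * real (card (limb f n)) + K \<and>
    (h - \<epsilon>) * real (card (limb f n)) \<le> log_min (limb f n) + K"
proof -
  define others where "others = UNIV - {f}"
  define c where "c l = (\<Sum>h\<in>others. passages l h)" for l
  define r where "r = (\<Sum>h\<in>others. excursion_size N h)"
  have R_f: "{h. R f h} = insert f others" by (auto simp: full others_def)
  have split_f: "(\<Sum>h | R f h. q h) = q f + (\<Sum>h\<in>others. q h)" for q :: "'d \<Rightarrow> real"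
    unfolding R_f by (subst sum.insert) (auto simp: others_def)
  have passage: "(\<Sum>h\<in>others. q (limb h n)) \<le> b * r + (\<Sum>l\<le>N. c l * q (limb f (n - l)))"
    if "subadditive_on_trees q b" "N \<le> n" for q b n
  proof -
    have "(\<Sum>h\<in>others. q (limb h n)) \<le>
        (\<Sum>h\<in>others. b * excursion_size N h + (\<Sum>l\<le>N. passages l h * q (limb f (n - l))))"
      by (intro sum_mono first_passage[of "\<lambda>h n. q (limb h n)"] subadditive_limb that)
    also have "\<dots> = b * r + (\<Sum>l\<le>N. c l * q (limb f (n - l)))"
      unfolding sum.distrib r_def c_def sum_distrib_right
      by (subst sum.swap) (simp add: sum_distrib_left)
    finally show ?thesis .
  qed
  have step: "q (limb f (Suc n)) \<le> b * (1 + r) + q (limb f n) + (\<Sum>l\<le>N. c l * q (limb f (n - l)))"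
    if "subadditive_on_trees q b" "N \<le> n" for q b n
    using subadditive_limb[OF that(1), of f n] passage[OF that] by (simp add: split_f algebra_simps)
  have c: "0 \<le> c l" for l unfolding c_def by (intro sum_nonneg passages_nonneg)
  interpret branching_comparison "\<lambda>n. real (card (limb f n))" "\<lambda>n. log_total (limb f n)"
    "\<lambda>n. log_count (limb f n)" E c N p "1 + r" "ln (real CARD('k)) * (1 + r)" "ln (real CARD('k))"
  proof
    show "0 \<le> c l" for l by (rule c)
    \<comment> \<open>The index \<open>1\<close> counts from the child \<open>g\<close> of the root, hence the passage \<open>g f\<close> of length two.\<close>
    have "1 \<le> passages 1 g"
      using assms(2) by (simp cong: if_cong)
    also have "\<dots> \<le> c 1"
      unfolding c_def using assms(1) passages_nonneg
      by (intro member_le_sum) (auto simp: others_def simp del: passages.simps)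
    also have "\<dots> \<le> (\<Sum>l\<le>N. c l)"
      using N_pos c by (intro member_le_sum) auto
    finally show "0 < (\<Sum>l\<le>N. c l)" by simp
    have "0 \<le> r" unfolding r_def by (intro sum_nonneg excursion_size_nonneg)
    then show "0 \<le> 1 + r" "0 \<le> ln (real CARD('k)) * (1 + r)" by (auto simp: Suc_le_eq)
    show "0 < real (card (limb f n))" for n
      using card_limb_ge[of f n, OF full] by simp
    show "mono (\<lambda>n. real (card (limb f n)))"
      by (intro monoI of_nat_mono card_mono limb_mono is_treeD(1)[OF is_tree_limb])
    show "filterlim (\<lambda>n. real (card (limb f n))) at_top sequentially"
      by (rule card_limb_at_top)
    fix n assume n: "N \<le> n"
    show "real (card (limb f (Suc n))) = 1 + r + real (card (limb f n)) +
        (\<Sum>l\<le>N. c l * real (card (limb f (n - l))))"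
      using step[OF subadditive_card(1) n] step[OF subadditive_card(2) n] by (simp add: sum_negf)
    show "log_total (limb f (Suc n)) \<le> ln (real CARD('k)) * (1 + r) + log_total (limb f n) +
        (\<Sum>l\<le>N. c l * log_total (limb f (n - l)))"
      by (rule step[OF subadditive_log_total n])
    fix i j assume "E i j"
    have "(\<Sum>l\<le>N. c l * log_min (limb f (n - l))) \<le> (\<Sum>h\<in>others. log_min (limb h n))"
      using passage[OF subadditive_log_min n] by (simp add: sum_negf)
    also have "\<dots> = (\<Sum>h\<in>heads (limb f (Suc n)) - {f}. log_min (subtree h (limb f (Suc n))))"
      by (rule sum.cong) (auto simp: others_def heads_limb full subtree_limb)
    finally show "log_count (limb f n) j + (\<Sum>l\<le>N. c l * Min (range (log_count (limb f (n - l)))))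
        \<le> log_count (limb f (Suc n)) i"
      using log_count_subtrees_distinguished[OF is_tree_limb _ \<open>E i j\<close>, of f f "Suc n"]
      by (simp add: heads_limb full subtree_limb flip: log_min_def)
  next
    show "log_count (limb f n) i \<le> log_total (limb f n)" for n i
      by (rule log_count_le_log_total[OF is_tree_limb])
    show "\<exists>i. log_total (limb f n) \<le> log_count (limb f n) i + ln (real CARD('k))" for n
      by (rule log_total_le_log_count[OF is_tree_limb])
    show "p \<le> t \<Longrightarrow> (E ^^ t) i j" for t i j by (rule primitive_ge)
  qed
  obtain h where h: "\<forall>\<epsilon>>0. \<exists>K. \<forall>n. log_total (limb f n) \<le> (h + \<epsilon>) * real (card (limb f n)) + K \<and>
      (\<forall>i. (h - \<epsilon>) * real (card (limb f n)) \<le> log_count (limb f n) i + K)"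
    using common_rate by blast
  show ?thesis
  proof (rule exI[of _ h], intro allI impI)
    fix \<epsilon> :: real assume "0 < \<epsilon>"
    then obtain K where K: "\<And>n. log_total (limb f n) \<le> (h + \<epsilon>) * real (card (limb f n)) + K"
        "\<And>n i. (h - \<epsilon>) * real (card (limb f n)) - K \<le> log_count (limb f n) i"
      using h by (metis diff_le_eq)
    have "(h - \<epsilon>) * real (card (limb f n)) - K \<le> log_min (limb f n)" for n
      unfolding log_min_def using K(2) by simp
    then show "\<exists>K. \<forall>n. log_total (limb f n) \<le> (h + \<epsilon>) * real (card (limb f n)) + K \<and>
        (h - \<epsilon>) * real (card (limb f n)) \<le> log_min (limb f n) + K"
      using K(1) by (intro exI[of _ K]) (simp add: diff_le_eq)
  qed
qed

end

section \<open>Strips along a ray\<close>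

context recurrent_alphabet
begin

text \<open>
  The strip of width \<open>n\<close> and length \<open>m\<close> along the ray \<open>y 1, y 2, \<dots>\<close>, below a vertex with last
  letter \<open>y 0\<close>. Recording this letter lets the strip be cut after its first vertex: the subtree at \<open>y 1\<close> is
  again a strip, along the shifted sequence.
\<close>

definition spine :: "(nat \<Rightarrow> 'd) \<Rightarrow> nat \<Rightarrow> nat \<Rightarrow> 'd list set" where
  "spine y n m = {map y [1..<Suc j] @ v | j v.
     j < m \<and> successively R (y j # v) \<and> length v < n \<and> (v = [] \<or> hd v \<noteq> y (Suc j))}"

lemma map_shift: "map y [1..<Suc (Suc j)] = y 1 # map (y \<circ> Suc) [1..<Suc j]"
proof -
  have "[1..<Suc (Suc j)] = 1 # map Suc [1..<Suc j]"
    by (simp add: upt_conv_Cons map_Suc_upt del: upt_Suc)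
  then show ?thesis by (simp del: upt_Suc)
qed

lemma spine_Cons:
  "h # w \<in> spine y n (Suc m) \<longleftrightarrow>
     (if h = y 1 then w \<in> spine (y \<circ> Suc) n m
      else R (y 0) h \<and> successively R (h # w) \<and> Suc (length w) < n)"
proof
  assume "h # w \<in> spine y n (Suc m)"
  then obtain j v where jv: "h # w = map y [1..<Suc j] @ v" "j < Suc m"
      "successively R (y j # v)" "length v < n" "v = [] \<or> hd v \<noteq> y (Suc j)"
    by (auto simp: spine_def simp del: upt_Suc)
  show "if h = y 1 then w \<in> spine (y \<circ> Suc) n m
      else R (y 0) h \<and> successively R (h # w) \<and> Suc (length w) < n"
  proof (cases j)
    case 0
    then show ?thesis using jv by auto
  next
    case (Suc i)
    then have "h = y 1" "w = map (y \<circ> Suc) [1..<Suc i] @ v"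
      using jv(1) by (simp_all only: map_shift) simp_all
    then show ?thesis using jv Suc by (auto simp: spine_def simp del: upt_Suc)
  qed
next
  assume *: "if h = y 1 then w \<in> spine (y \<circ> Suc) n m
      else R (y 0) h \<and> successively R (h # w) \<and> Suc (length w) < n"
  show "h # w \<in> spine y n (Suc m)"
  proof (cases "h = y 1")
    case True
    then obtain j v where jv: "w = map (y \<circ> Suc) [1..<Suc j] @ v" "j < m"
        "successively R (y (Suc j) # v)" "length v < n" "v = [] \<or> hd v \<noteq> y (Suc (Suc j))"
      using * by (auto simp: spine_def simp del: upt_Suc)
    then have "h # w = map y [1..<Suc (Suc j)] @ v"
      using True by (simp only: map_shift append_Cons)
    with jv show ?thesis unfolding spine_def by blast
  next
    case False
    then have "h # w = map y [1..<Suc 0] @ (h # w) \<and> 0 < Suc m \<and> successively R (y 0 # h # w) \<and>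
        length (h # w) < n \<and> (h # w = [] \<or> hd (h # w) \<noteq> y (Suc 0))"
      using * by simp
    then show ?thesis unfolding spine_def by blast
  qed
qed

lemma Nil_in_spine: "0 < n \<Longrightarrow> [] \<in> spine y n (Suc m)"
  unfolding spine_def by (intro CollectI exI[of _ 0] exI[of _ "[]"]) simp

lemma spine_0: "spine y n 0 = {}"
  by (simp add: spine_def)

lemma subtree_spine:
  "subtree (y 1) (spine y n (Suc m)) = spine (y \<circ> Suc) n m"
  "h \<in> heads (spine y n (Suc m)) \<Longrightarrow> h \<noteq> y 1 \<Longrightarrow> subtree h (spine y n (Suc m)) = limb h (n - 2)"
  by (auto simp: subtree_def heads_def spine_Cons limb_def)

lemma finite_spine: "finite (spine y n m)"
proof (induction m arbitrary: y)
  case (Suc m)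
  have "spine y n (Suc m) \<subseteq>
      insert [] ((#) (y 1) ` spine (y \<circ> Suc) n m \<union> (\<Union>h. (#) h ` limb h n))"
  proof
    fix w assume "w \<in> spine y n (Suc m)"
    then show "w \<in> insert [] ((#) (y 1) ` spine (y \<circ> Suc) n m \<union> (\<Union>h. (#) h ` limb h n))"
    proof (cases w)
      case (Cons h v)
      have "v \<in> limb h n" if "h \<noteq> y 1"
        using \<open>w \<in> _\<close> that by (simp add: Cons spine_Cons limb_def)
      moreover have "v \<in> spine (y \<circ> Suc) n m" if "h = y 1"
        using \<open>w \<in> _\<close> that by (simp only: Cons spine_Cons if_True)
      ultimately show ?thesis using Cons by blast
    qed simp
  qed
  moreover have "finite \<dots>"
    by (intro finite.insertI finite_UnI finite_imageI finite_UN_I Suc.IH finite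
        is_treeD(1)[OF is_tree_limb])
  ultimately show ?case by (rule finite_subset)
qed (simp add: spine_0)

lemma is_tree_spine:
  assumes "0 < n" "0 < m"
  shows "is_tree (spine y n m)"
proof -
  have "u @ v \<in> spine y n m \<Longrightarrow> u \<in> spine y n m" for u v
  proof (induction m arbitrary: y u)
    case (Suc m)
    show ?case
    proof (cases u)
      case Nil
      then show ?thesis using Nil_in_spine[OF assms(1)] by simp
    next
      case (Cons h u')
      show ?thesis
      proof (cases "h = y 1")
        case True
        then have "u' @ v \<in> spine (y \<circ> Suc) n m"
          using Suc.prems by (simp only: Cons append_Cons spine_Cons if_True)
        then show ?thesis using Suc.IH[of u' "y \<circ> Suc"] True by (simp only: Cons spine_Cons if_True refl)
      next
        case False
        then show ?thesis
          using Suc.prems successively_append_iff[of R "h # u'" v]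
          by (simp add: Cons spine_Cons del: successively.simps)
      qed
    qed
  qed (simp add: spine_0)
  moreover have "[] \<in> spine y n m"
    using assms Nil_in_spine by (cases m) auto
  ultimately show ?thesis using finite_spine unfolding is_tree_def by blast
qed

text \<open>
  A strip of length \<open>m + 1\<close> is a vertex, a strip of length \<open>m\<close> and at most \<open>d\<close> limbs.
\<close>

lemma subadditive_spine:
  assumes q: "subadditive_on_trees q b" and K: "\<And>g n. q (limb g n) \<le> K" "0 \<le> K"
    and "0 < n" "0 < m"
  shows "q (spine y n m) \<le> real m * (\<bar>b\<bar> + real CARD('d) * K)"
  using \<open>0 < m\<close>
proof (induction m arbitrary: y)
  case (Suc m)
  define H where "H = heads (spine y n (Suc m))"
  let ?F = "spine y n (Suc m)"
  have tree: "is_tree ?F" using is_tree_spine assms(4) by simp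
  have fin: "finite H" using finite_heads[OF tree] by (simp add: H_def)
  have "(\<Sum>g\<in>H - {y 1}. q (subtree g ?F)) \<le> real (card (H - {y 1})) * K"
    by (rule sum_bounded_above) (auto simp: H_def subtree_spine K)
  also have "\<dots> \<le> real CARD('d) * K"
    using K by (intro mult_right_mono of_nat_mono card_mono) auto
  finally have side: "(\<Sum>g\<in>H - {y 1}. q (subtree g ?F)) \<le> real CARD('d) * K" .
  have "(\<Sum>g\<in>H. q (subtree g ?F)) \<le> real m * (\<bar>b\<bar> + real CARD('d) * K) + real CARD('d) * K"
  proof (cases "y 1 \<in> H")
    case True
    then have "0 < m"
      unfolding H_def heads_def by (cases m) (auto simp: spine_Cons spine_0)
    have "(\<Sum>g\<in>H. q (subtree g ?F)) =
        q (spine (y \<circ> Suc) n m) + (\<Sum>g\<in>H - {y 1}. q (subtree g ?F))"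
      by (subst sum.remove[OF fin True]) (simp only: subtree_spine(1))
    then show ?thesis
      using Suc.IH[OF \<open>0 < m\<close>, of "y \<circ> Suc"] side by linarith
  next
    case False
    have "0 \<le> real m * (\<bar>b\<bar> + real CARD('d) * K)" using K by simp
    then show ?thesis using side False by simp
  qed
  moreover have "q ?F \<le> b + (\<Sum>g\<in>H. q (subtree g ?F))"
    using q tree unfolding subadditive_on_trees_def H_def by blast
  ultimately show ?case by (simp add: algebra_simps)
qed simp

text \<open>
  Where the ray passes \<open>f\<close>, a child \<open>h\<close> off the ray with \<open>R h f\<close> exists: \<open>f\<close> itself if the ray leaves
  towards another letter, and \<open>g\<close> otherwise. Its limb of depth \<open>n - 2\<close> contains the words \<open>f f \<dots> f\<close>.
\<close>

lemma card_spine_visits: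
  assumes "g \<noteq> f" "R g f" "2 \<le> n"
  shows "(n - 1) * card {j. j < m \<and> y j = f} \<le> card (spine y n m)"
proof (induction m arbitrary: y)
  case (Suc m)
  let ?F = "spine y n (Suc m)"
  have tree: "is_tree ?F" using is_tree_spine assms(3) by simp
  have fin: "finite (heads ?F)" by (rule finite_heads[OF tree])
  have "{j. j < Suc m \<and> y j = f} =
      (if y 0 = f then {0} else {}) \<union> Suc ` {j. j < m \<and> (y \<circ> Suc) j = f}"
    by (auto simp: image_iff less_Suc_eq_0_disj)
  then have "card {j. j < Suc m \<and> y j = f} =
      of_bool (y 0 = f) + card {j. j < m \<and> (y \<circ> Suc) j = f}"
    by (auto simp: card_image)
  then have "(n - 1) * card {j. j < Suc m \<and> y j = f} =
      (n - 1) * of_bool (y 0 = f) + (n - 1) * card {j. j < m \<and> (y \<circ> Suc) j = f}"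
    by (simp only: distrib_left)
  also have "\<dots> \<le> (n - 1) * of_bool (y 0 = f) + card (spine (y \<circ> Suc) n m)"
    using Suc.IH by (rule add_left_mono)
  also have "\<dots> \<le> (\<Sum>h\<in>heads ?F - {y 1}. card (subtree h ?F)) + card (subtree (y 1) ?F)"
  proof (rule add_mono)
    show "(n - 1) * of_bool (y 0 = f) \<le> (\<Sum>h\<in>heads ?F - {y 1}. card (subtree h ?F))"
    proof (cases "y 0 = f")
      case True
      define h where "h = (if y 1 = f then g else f)"
      have h: "h \<noteq> y 1" "R h f"
        using assms full by (auto simp: h_def)
      then have "h \<in> heads ?F"
        using True full assms(3) by (auto simp: heads_def spine_Cons)
      have "n - 1 \<le> card (limb h (n - 2))"
        using card_limb_ge[OF h(2), of "n - 2"] by simp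
      also have "\<dots> = card (subtree h ?F)"
        using subtree_spine(2)[OF \<open>h \<in> heads ?F\<close> h(1)] by simp
      also have "\<dots> \<le> (\<Sum>h\<in>heads ?F - {y 1}. card (subtree h ?F))"
        using \<open>h \<in> heads ?F\<close> h(1) fin by (intro member_le_sum) auto
      finally show ?thesis by simp
    qed simp
  qed (simp only: subtree_spine(1))
  also have "\<dots> \<le> card ?F"
  proof (cases "y 1 \<in> heads ?F")
    case True
    then show ?thesis
      unfolding card_tree[OF tree] by (subst sum.remove[OF fin True]) simp
  next
    case False
    then have "subtree (y 1) ?F = {}"
      using is_treeD(4)[OF tree] by (auto simp: subtree_def)
    with False show ?thesis unfolding card_tree[OF tree] by simp
  qed
  finally show ?case .
qed simp

lemma visits_ge:
  assumes "\<And>j. R (y j) (y (Suc j))"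
  shows "m div N \<le> card {j. j < m \<and> y j = f}"
proof -
  have walk: "successively R (map y [a..<a + l])" for a l
    using assms by (auto simp: successively_conv_nth)
  have "\<exists>j. a \<le> j \<and> j < a + N \<and> y j = f" for a
    using recurrent[OF walk, of a N] by auto
  then obtain v where v: "\<And>a. a \<le> v a" "\<And>a. v a < a + N" "\<And>a. y (v a) = f"
    by metis
  have "inj_on (\<lambda>t. v (t * N)) {..<m div N}"
  proof (rule inj_onI)
    fix s t assume "v (s * N) = v (t * N)"
    moreover have "v (t * N) div N = t" for t
      using v(1,2)[of "t * N"] by (intro div_nat_eqI) (auto simp: algebra_simps)
    ultimately show "s = t" by metis
  qed
  moreover have "(\<lambda>t. v (t * N)) ` {..<m div N} \<subseteq> {j. j < m \<and> y j = f}"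
  proof (intro image_subsetI CollectI conjI v(3))
    fix t assume "t \<in> {..<m div N}"
    then have "Suc t * N \<le> m"
      by (metis Suc_leI lessThan_iff less_eq_div_iff_mult_less_eq N_pos)
    then show "v (t * N) < m" using v(2)[of "t * N"] by simp
  qed
  ultimately show ?thesis
    using card_inj_on_le[of "\<lambda>t. v (t * N)" "{..<m div N}" "{j. j < m \<and> y j = f}"] by simp
qed

end

section \<open>The entropy of strips\<close>

context hom_entropy
begin

text \<open>
  The errors \<open>q1\<close> and \<open>q2\<close> of the upper and the lower estimate with rates \<open>h \<plusminus> \<eta>\<close> are subadditive on
  trees and bounded on balls, hence at most \<open>m * B\<close> on a strip of length \<open>m\<close>. The size of the strip
  exceeds \<open>m * B / \<eta>\<close> as soon as \<open>n\<close> is large, uniformly in \<open>m \<ge> N\<close> and in the ray.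
\<close>

theorem spine_rate:
  assumes "g \<noteq> f" "R g f"
  shows "\<exists>h. ((\<lambda>n. log_total (limb f n) / real (card (limb f n))) \<longlonglongrightarrow> h) \<and>
    (\<forall>\<epsilon>>0. \<exists>n0. \<forall>n\<ge>n0. \<forall>y m. (\<forall>j. R (y j) (y (Suc j))) \<longrightarrow> N \<le> m \<longrightarrow>
      \<bar>log_total (spine y n m) / real (card (spine y n m)) - h\<bar> \<le> \<epsilon>)"
proof -
  obtain h where h: "\<And>\<epsilon>. 0 < \<epsilon> \<Longrightarrow> \<exists>K. \<forall>n.
      log_total (limb f n) \<le> (h + \<epsilon>) * real (card (limb f n)) + K \<and>
      (h - \<epsilon>) * real (card (limb f n)) \<le> log_min (limb f n) + K"
    using common_rate_limb[OF assms] by blast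
  have log_min_le_total: "log_min F \<le> log_total F" if "is_tree F" for F :: "'d list set"
    using log_min_le log_count_le_log_total[OF that] by (meson order_trans)
  show ?thesis
  proof (intro exI[of _ h] conjI allI impI)
    show "(\<lambda>n. log_total (limb f n) / real (card (limb f n))) \<longlonglongrightarrow> h"
    proof (rule tendstoI)
      fix \<epsilon> :: real assume "0 < \<epsilon>"
      then obtain K where K: "\<And>n. log_total (limb f n) \<le> (h + \<epsilon> / 3) * real (card (limb f n)) + K"
          "\<And>n. (h - \<epsilon> / 3) * real (card (limb f n)) \<le> log_min (limb f n) + K"
        using h[of "\<epsilon> / 3"] by auto
      have "eventually (\<lambda>n. max 1 (3 * \<bar>K\<bar> / \<epsilon>) \<le> real (card (limb f n))) sequentially"
        using card_limb_at_top unfolding filterlim_at_top by blast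
      then show "eventually (\<lambda>n. dist (log_total (limb f n) / real (card (limb f n))) h < \<epsilon>) sequentially"
      proof eventually_elim
        case (elim n)
        define z where "z = real (card (limb f n))"
        have z: "0 < z" "\<bar>K\<bar> \<le> \<epsilon> / 3 * z"
          using elim \<open>0 < \<epsilon>\<close> by (auto simp: z_def field_simps)
        have "log_total (limb f n) \<le> h * z + 2 * (\<epsilon> / 3 * z)" "h * z - 2 * (\<epsilon> / 3 * z) \<le> log_total (limb f n)"
          using K[of n] z log_min_le_total[OF is_tree_limb, of f n]
          unfolding z_def[symmetric] distrib_right left_diff_distrib by linarith+
        then have "\<bar>log_total (limb f n) - h * z\<bar> \<le> 2 * (\<epsilon> / 3 * z)"
          by linarith
        then have "\<bar>log_total (limb f n) - h * z\<bar> \<le> 2 * \<epsilon> / 3 * z"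
          by simp
        then have "\<bar>log_total (limb f n) / z - h\<bar> \<le> 2 * \<epsilon> / 3"
          using z by (simp add: field_simps abs_le_iff)
        then show ?case
          using \<open>0 < \<epsilon>\<close> by (simp add: dist_real_def z_def)
      qed
    qed
  next
    fix \<epsilon> :: real assume "0 < \<epsilon>"
    define \<eta> where "\<eta> = \<epsilon> / 2"
    have "0 < \<eta>" using \<open>0 < \<epsilon>\<close> by (simp add: \<eta>_def)
    define q1 where "q1 F = log_total F - (h + \<eta>) * real (card F)" for F :: "'d list set"
    define q2 where "q2 F = (h - \<eta>) * real (card F) - log_min F" for F :: "'d list set"
    obtain K0 where K0: "\<And>n. q1 (limb f n) \<le> K0" "\<And>n. q2 (limb f n) \<le> K0"
      using h[OF \<open>0 < \<eta>\<close>] unfolding q1_def q2_def by (metis diff_le_eq add.commute)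
    have card_eq: "real (card F) = 1 + (\<Sum>g\<in>heads F. real (card (subtree g F)))"
      if "is_tree F" for F :: "'d list set"
      using card_tree[OF that] by simp
    have sub1: "subadditive_on_trees q1 (ln (real CARD('k)) - (h + \<eta>))"
      unfolding subadditive_on_trees_def q1_def
    proof (intro allI impI)
      fix F :: "'d list set" assume F: "is_tree F"
      show "log_total F - (h + \<eta>) * real (card F) \<le> ln (real CARD('k)) - (h + \<eta>) +
          (\<Sum>g\<in>heads F. log_total (subtree g F) - (h + \<eta>) * real (card (subtree g F)))"
        using log_total_subtrees[OF F]
        unfolding card_eq[OF F] sum_subtractf distrib_left sum_distrib_left by simp
    qed
    have sub2: "subadditive_on_trees q2 (h - \<eta>)"
      unfolding subadditive_on_trees_def q2_def
    proof (intro allI impI)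
      fix F :: "'d list set" assume F: "is_tree F"
      show "(h - \<eta>) * real (card F) - log_min F \<le> h - \<eta> +
          (\<Sum>g\<in>heads F. (h - \<eta>) * real (card (subtree g F)) - log_min (subtree g F))"
        using log_min_subtrees[OF F]
        unfolding card_eq[OF F] sum_subtractf distrib_left sum_distrib_left by simp
    qed
    obtain K1 where K1: "0 \<le> K1" "\<And>g n. q1 (limb g n) \<le> K1"
      using bounded_at_all_letters[of "\<lambda>g n. q1 (limb g n)", OF subadditive_limb[OF sub1] K0(1)]
      by blast
    obtain K2 where K2: "0 \<le> K2" "\<And>g n. q2 (limb g n) \<le> K2"
      using bounded_at_all_letters[of "\<lambda>g n. q2 (limb g n)", OF subadditive_limb[OF sub2] K0(2)]
      by blast
    define B where "B = (\<bar>ln (real CARD('k)) - (h + \<eta>)\<bar> + real CARD('d) * K1) +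
      (\<bar>h - \<eta>\<bar> + real CARD('d) * K2)"
    have B: "q1 (spine y n m) \<le> real m * B" "q2 (spine y n m) \<le> real m * B"
      if "0 < n" "0 < m" for y n m
    proof -
      have "0 \<le> real m * (\<bar>ln (real CARD('k)) - (h + \<eta>)\<bar> + real CARD('d) * K1)"
           "0 \<le> real m * (\<bar>h - \<eta>\<bar> + real CARD('d) * K2)"
        using K1(1) K2(1) by auto
      then show "q1 (spine y n m) \<le> real m * B" "q2 (spine y n m) \<le> real m * B"
        using subadditive_spine[OF sub1 K1(2,1) that, of y] subadditive_spine[OF sub2 K2(2,1) that, of y]
        unfolding B_def distrib_left by linarith+
    qed
    have "0 \<le> B" using K1(1) K2(1) by (simp add: B_def)
    obtain n0 where n0: "2 * real N * B / \<eta> \<le> real n0" using real_arch_simple by blast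
    show "\<exists>n0. \<forall>n\<ge>n0. \<forall>y m. (\<forall>j. R (y j) (y (Suc j))) \<longrightarrow> N \<le> m \<longrightarrow>
      \<bar>log_total (spine y n m) / real (card (spine y n m)) - h\<bar> \<le> \<epsilon>"
    proof (intro exI[of _ "n0 + 2"] allI impI)
      fix n m and y :: "nat \<Rightarrow> 'd"
      assume n: "n0 + 2 \<le> n" and y: "\<forall>j. R (y j) (y (Suc j))" and m: "N \<le> m"
      define F where "F = spine y n m"
      define z where "z = real (card F)"
      have pos: "0 < n" "0 < m" "1 \<le> m div N"
        using n m N_pos by (auto simp: div_greater_zero_iff Suc_le_eq)
      have tree: "is_tree F" unfolding F_def by (rule is_tree_spine[OF pos(1,2)])
      have "0 < card F" using card_tree[OF tree] by linarith
      then have "0 < z" by (simp add: z_def)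
      \<comment> \<open>The assumption \<open>N \<le> m\<close> absorbs the remainder of the division by \<open>N\<close> into the quotient.\<close>
      have "m \<le> N * (m div N) + N"
        using div_mult_mod_eq[of m N] mod_less_divisor[OF N_pos, of m]
        unfolding mult.commute[of N] by linarith
      also have "\<dots> \<le> 2 * N * (m div N)"
        using pos(3) by (simp add: algebra_simps)
      finally have m_le: "real m \<le> 2 * real N * real (m div N)"
        by (metis of_nat_le_iff of_nat_mult of_nat_numeral)
      have "real (n - 1) * real (m div N) \<le> z"
      proof -
        have "(n - 1) * (m div N) \<le> (n - 1) * card {j. j < m \<and> y j = f}"
          using visits_ge[of y m] y by (intro mult_left_mono) auto
        also have "\<dots> \<le> card F"
          unfolding F_def using n by (intro card_spine_visits[OF assms]) simp
        finally show ?thesis unfolding z_def by (metis of_nat_le_iff of_nat_mult)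
      qed
      moreover have "2 * real N * B \<le> \<eta> * real (n - 1)"
      proof -
        have "2 * real N * B \<le> \<eta> * real n0" using n0 \<open>0 < \<eta>\<close> by (simp add: field_simps)
        also have "\<dots> \<le> \<eta> * real (n - 1)" using n \<open>0 < \<eta>\<close> by (intro mult_left_mono) auto
        finally show ?thesis .
      qed
      ultimately have "real m * B \<le> \<eta> * z"
      proof -
        assume a: "real (n - 1) * real (m div N) \<le> z" and b: "2 * real N * B \<le> \<eta> * real (n - 1)"
        have "real m * B \<le> 2 * real N * real (m div N) * B"
          using m_le \<open>0 \<le> B\<close> by (rule mult_right_mono)
        also have "\<dots> = 2 * real N * B * real (m div N)" by simp
        also have "\<dots> \<le> \<eta> * real (n - 1) * real (m div N)"
          using b by (rule mult_right_mono) simp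
        also have "\<dots> \<le> \<eta> * z"
          using mult_left_mono[OF a, of \<eta>] \<open>0 < \<eta>\<close> by (simp add: mult.assoc)
        finally show ?thesis .
      qed
      then have "log_total F \<le> h * z + 2 * (\<eta> * z)" "h * z - 2 * (\<eta> * z) \<le> log_total F"
        using B[OF pos(1,2), of y] log_min_le_total[OF tree]
        unfolding q1_def q2_def F_def[symmetric] z_def[symmetric] distrib_right left_diff_distrib
        by linarith+
      then have "\<bar>log_total F - h * z\<bar> \<le> \<epsilon> * z"
        by (simp add: abs_le_iff \<eta>_def)
      then have "\<bar>log_total F / z - h\<bar> \<le> \<epsilon>"
        using \<open>0 < z\<close> by (simp add: field_simps abs_le_iff)
      then show "\<bar>log_total (spine y n m) / real (card (spine y n m)) - h\<bar> \<le> \<epsilon>"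
        by (simp add: F_def z_def)
    qed
  qed
qed

end

context hom_entropy
begin

text \<open>
  The tree is a path. Both the balls and the strips are its initial segments, and the numbers of walks in
  \<open>E\<close> are submultiplicative in the length.
\<close>

lemma spine_rate_single_letter:
  assumes single: "\<And>g. g = f"
  shows "\<exists>h. ((\<lambda>n. log_total (limb f n) / real (card (limb f n))) \<longlonglongrightarrow> h) \<and>
    (\<forall>n\<ge>1. \<forall>y. (\<lambda>m. log_total (spine y n m) / real (card (spine y n m))) \<longlonglongrightarrow> h)"
proof -
  have R: "R g h" for g h using full single by metis
  have words: "successively R w" for w using R by (induction w rule: induct_list012) auto
  have limb: "limb g n = {w. length w \<le> n}" for g n by (auto simp: limb_def words)
  have heads: "heads (limb f (Suc n)) = {f}" for n
    using single by (auto simp: heads_limb full)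
  have card_limb_Suc: "card (limb f (Suc n)) = Suc (card (limb f n))" for n
    using card_tree[OF is_tree_limb, of f "Suc n"] by (simp add: heads subtree_limb full)
  have "limb f 0 = {[]}" by (auto simp: limb)
  then have card_limb: "card (limb f n) = Suc n" for n
    by (induction n) (simp_all add: card_limb_Suc)
  define x where "x n i = card (homs E (limb f n) i)" for n i
  have x0: "x 0 i = 1" for i
    unfolding x_def card_homs[OF is_tree_limb] by (simp add: heads_def limb_def)
  have x_Suc: "x (Suc n) i = (\<Sum>j | E i j. x n j)" for n i
    using card_homs[OF is_tree_limb, of E f "Suc n" i]
    by (simp add: x_def heads subtree_limb full)
  have "x (m + n) i \<le> x m i * total (limb f n)" for m n i
  proof (induction m arbitrary: i)
    case 0
    have "x n i \<le> total (limb f n)"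
      unfolding x_def total_def by (rule member_le_sum) auto
    then show ?case by (simp add: x0)
  next
    case (Suc m)
    show ?case
      using Suc.IH by (simp add: x_Suc sum_distrib_right sum_mono)
  qed
  then have "total (limb f (m + n)) \<le> total (limb f m) * total (limb f n)" for m n
    unfolding total_def[of "limb f (m + n)"] total_def[of "limb f m"] x_def[symmetric]
      sum_distrib_right by (intro sum_mono)
  then have "real (total (limb f (m + n))) \<le> real (total (limb f m)) * real (total (limb f n))" for m n
    by (metis of_nat_le_iff of_nat_mult)
  then have "log_total (limb f (m + n)) \<le> ln (real (total (limb f m)) * real (total (limb f n)))" for m n
    unfolding log_total_def using total_pos[OF is_tree_limb]
    by (subst ln_le_cancel_iff) auto
  then have sub: "log_total (limb f (m + n)) \<le> log_total (limb f m) + log_total (limb f n)" for m n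
    using total_pos[OF is_tree_limb, of f m] total_pos[OF is_tree_limb, of f n]
    unfolding log_total_def by (metis ln_mult_pos of_nat_0_less_iff)
  have "0 \<le> log_total (limb f n)" for n
    unfolding log_total_def using total_pos[OF is_tree_limb, of f n] by simp
  then obtain h where h: "(\<lambda>n. log_total (limb f n) / real n) \<longlonglongrightarrow> h"
    using subadditive_sequence_converges[of "\<lambda>n. log_total (limb f n)", OF sub] by blast
  have "(\<lambda>n. log_total (limb f n) / real n * (real n / real (Suc n))) \<longlonglongrightarrow> h * 1"
    by (intro tendsto_mult h LIMSEQ_n_over_Suc_n)
  moreover have "eventually (\<lambda>n. log_total (limb f n) / real n * (real n / real (Suc n)) =
      log_total (limb f n) / real (card (limb f n))) sequentially"
    using eventually_gt_at_top[of 0] by eventually_elim (simp add: card_limb)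
  ultimately have limit: "(\<lambda>n. log_total (limb f n) / real (card (limb f n))) \<longlonglongrightarrow> h"
    using tendsto_cong by fastforce
  have "w \<in> spine y n (Suc m) \<longleftrightarrow> length w \<le> m" if "1 \<le> n" for w y n m
  proof (induction m arbitrary: w y)
    case 0
    show ?case
      using Nil_in_spine[of n y 0] that single[of "hd w"] single[of "y 1"]
      by (cases w) (auto simp: spine_Cons spine_0)
  next
    case (Suc m)
    show ?case
    proof (cases w)
      case (Cons g v)
      then show ?thesis
        using Suc[of v "y \<circ> Suc"] single[of g] single[of "y 1"] by (simp only: spine_Cons) simp
    qed (use Nil_in_spine that in auto)
  qed
  then have "spine y n (Suc m) = limb f m" if "1 \<le> n" for y n m
    using that by (auto simp: limb)
  then have "(\<lambda>m. log_total (spine y n m) / real (card (spine y n m))) \<longlonglongrightarrow> h" if "1 \<le> n" for y n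
    using that limit
    by (subst filterlim_sequentially_Suc[symmetric]) simp
  with limit show ?thesis by blast
qed

theorem spine_entropy:
  assumes "(\<forall>g. g = f) \<or> (\<exists>g. g \<noteq> f \<and> R g f)"
  obtains h where "(\<lambda>n. log_total (limb f n) / real (card (limb f n))) \<longlonglongrightarrow> h"
    and "\<And>\<epsilon>. 0 < \<epsilon> \<Longrightarrow> \<exists>n0. \<forall>n\<ge>n0. \<forall>y. (\<forall>j. R (y j) (y (Suc j))) \<longrightarrow>
      (\<forall>\<^sub>F m in sequentially.
        \<bar>log_total (spine y n m) / real (card (spine y n m)) - h\<bar> \<le> \<epsilon>)"
  using assms
proof (elim disjE)
  assume "\<forall>g. g = f"
  then obtain h where h: "(\<lambda>n. log_total (limb f n) / real (card (limb f n))) \<longlonglongrightarrow> h"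
      "\<And>n y. 1 \<le> n \<Longrightarrow> (\<lambda>m. log_total (spine y n m) / real (card (spine y n m))) \<longlonglongrightarrow> h"
    using spine_rate_single_letter by blast
  show thesis
  proof (rule that[OF h(1)])
    fix \<epsilon> :: real assume "0 < \<epsilon>"
    have "\<forall>\<^sub>F m in sequentially.
        \<bar>log_total (spine y n m) / real (card (spine y n m)) - h\<bar> \<le> \<epsilon>" if "1 \<le> n" for n y
      using tendstoD[OF h(2)[OF that] \<open>0 < \<epsilon>\<close>, of y]
      by (rule eventually_mono) (simp add: dist_real_def)
    then show "\<exists>n0. \<forall>n\<ge>n0. \<forall>y. (\<forall>j. R (y j) (y (Suc j))) \<longrightarrow>
      (\<forall>\<^sub>F m in sequentially.
        \<bar>log_total (spine y n m) / real (card (spine y n m)) - h\<bar> \<le> \<epsilon>)"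
      by blast
  qed
next
  assume "\<exists>g. g \<noteq> f \<and> R g f"
  then obtain g where "g \<noteq> f" "R g f" by blast
  then obtain h where h: "(\<lambda>n. log_total (limb f n) / real (card (limb f n))) \<longlonglongrightarrow> h"
      "\<forall>\<epsilon>>0. \<exists>n0. \<forall>n\<ge>n0. \<forall>y m. (\<forall>j. R (y j) (y (Suc j))) \<longrightarrow> N \<le> m \<longrightarrow>
        \<bar>log_total (spine y n m) / real (card (spine y n m)) - h\<bar> \<le> \<epsilon>"
    using spine_rate by blast
  show thesis
  proof (rule that[OF h(1)])
    fix \<epsilon> :: real assume "0 < \<epsilon>"
    then obtain n0 where n0: "\<And>n y m. n0 \<le> n \<Longrightarrow> \<forall>j. R (y j) (y (Suc j)) \<Longrightarrow> N \<le> m \<Longrightarrow>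
        \<bar>log_total (spine y n m) / real (card (spine y n m)) - h\<bar> \<le> \<epsilon>"
      using h(2) by meson
    show "\<exists>n0. \<forall>n\<ge>n0. \<forall>y. (\<forall>j. R (y j) (y (Suc j))) \<longrightarrow>
      (\<forall>\<^sub>F m in sequentially.
        \<bar>log_total (spine y n m) / real (card (spine y n m)) - h\<bar> \<le> \<epsilon>)"
      by (intro exI[of _ n0] allI impI eventually_sequentiallyI[of N]) (rule n0; assumption)
  qed
qed

end

section \<open>Walks and patterns of the tree-shift\<close>

lemma positive_power_entry_walk:
  assumes "zero_one_matrix A" "matrix_power A m $ i $ j \<noteq> 0"
  shows "((\<lambda>i j. A $ i $ j = 1) ^^ m) i j"
  using assms(2)
proof (induction m arbitrary: i)
  case 0
  then show ?case by (auto simp: matrix_power_def mat_def split: if_splits)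
next
  case (Suc m)
  have "matrix_power A (Suc m) $ i $ j = (\<Sum>k\<in>UNIV. A $ i $ k * matrix_power A m $ k $ j)"
    by (simp add: matrix_power_def matrix_matrix_mult_def)
  then have "(\<Sum>k\<in>UNIV. A $ i $ k * matrix_power A m $ k $ j) \<noteq> 0"
    using Suc.prems by auto
  then obtain k where "A $ i $ k * matrix_power A m $ k $ j \<noteq> 0"
    by (rule sum.not_neutral_contains_not_neutral)
  then have "A $ i $ k = 1" "((\<lambda>i j. A $ i $ j = 1) ^^ m) k j"
    using assms(1) Suc.IH by (auto simp: zero_one_matrix_def)
  then show ?case by (rule relpowp_Suc_I2)
qed

context serial_graph
begin

text \<open>
  A labeling of a subtree is extended from the root outwards by arbitrary successors. The recursion runs
  on the reversed word since the label of a vertex depends on that of its parent.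
\<close>

primrec extend_rev :: "'d list set \<Rightarrow> ('d list \<Rightarrow> 'k) \<Rightarrow> 'd list \<Rightarrow> 'k" where
  "extend_rev F s [] = s []"
| "extend_rev F s (g # r) =
     (if rev (g # r) \<in> F then s (rev (g # r)) else next_label (extend_rev F s r))"

lemma extend_rev_in: "rev r \<in> F \<Longrightarrow> extend_rev F s r = s (rev r)"
  by (cases r) auto

end

lemma mc_tree_eq: "mc_tree M = {w. successively (\<lambda>f g. M $ f $ g = 1) w}"
  by (auto simp: mc_tree_def tree_level_def)

text \<open>
  A locally admissible labeling of a finite subtree extends to the whole tree because every label has a
  successor, so the patterns are exactly the labelings that respect the edges of the subtree.
\<close>

lemma card_patterns:
  fixes A :: "real ^ 'k ^ 'k" and M :: "real ^ 'd ^ 'd"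
  assumes "serial_graph (\<lambda>i j. A $ i $ j = 1)" "is_tree F" "F \<subseteq> mc_tree M"
  shows "card (patterns F (hom_tree_shift A M)) = serial_graph.total (\<lambda>i j. A $ i $ j = 1) F"
proof -
  interpret serial_graph "\<lambda>i j. A $ i $ j = 1" by fact
  let ?E = "\<lambda>i j. A $ i $ j = 1"
  have "patterns F (hom_tree_shift A M) = (\<Union>i. homs ?E F i)"
  proof (intro equalityI subsetI)
    fix u assume "u \<in> patterns F (hom_tree_shift A M)"
    then obtain t where t: "t \<in> hom_tree_shift A M" and u: "u = restrict t F"
      by (auto simp: patterns_def)
    have "?E (u w) (u (w @ [g]))" if "w @ [g] \<in> F" for w g
    proof -
      have "w \<in> F" using is_treeD(3)[OF assms(2) that] .
      with that assms(3) show ?thesis using t by (auto simp: u hom_tree_shift_def)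
    qed
    then have "u \<in> homs ?E F (u [])" by (simp add: homs_def u)
    then show "u \<in> (\<Union>i. homs ?E F i)" by blast
  next
    fix s assume "s \<in> (\<Union>i. homs ?E F i)"
    then have s: "s \<in> F \<rightarrow>\<^sub>E UNIV" "\<And>w g. w @ [g] \<in> F \<Longrightarrow> ?E (s w) (s (w @ [g]))"
      by (auto simp: homs_def)
    define t where "t = restrict (\<lambda>w. extend_rev F s (rev w)) (mc_tree M)"
    have "?E (t w) (t (w @ [g]))" if "w \<in> mc_tree M" "w @ [g] \<in> mc_tree M" for w g
    proof (cases "w @ [g] \<in> F")
      case True
      then have "w \<in> F" using is_treeD(3)[OF assms(2)] by blast
      then show ?thesis
        using that True s(2)[OF True] by (simp add: t_def extend_rev_in)
    next
      case False
      then show ?thesis using that next_label by (simp add: t_def)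
    qed
    then have "t \<in> hom_tree_shift A M" by (simp add: hom_tree_shift_def t_def)
    moreover have "s = restrict t F"
    proof
      fix w show "s w = restrict t F w"
        using s(1) assms(3)
        by (cases "w \<in> F") (auto simp: t_def extend_rev_in PiE_def extensional_def)
    qed
    ultimately show "s \<in> patterns F (hom_tree_shift A M)"
      by (auto simp: patterns_def)
  qed
  also have "card \<dots> = total F"
    unfolding total_def
    by (intro card_UN_disjoint) (auto simp: finite_homs is_treeD(1)[OF assms(2)] homs_disjoint)
  finally show ?thesis .
qed

section \<open>Complete prefix sets\<close>

text \<open>
  If all words may follow \<open>v\<close>, then in particular all letters may, so the row of the last letter
  of \<open>v\<close> is full.
\<close>

lemma complete_recursive_tree_prefixes:
  assumes "complete_recursive_tree M" "full_row M f" "\<And>g. full_row M g \<Longrightarrow> g = f"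
  obtains S where "complete_prefix_set M S" "\<And>v. v \<in> S \<Longrightarrow> v \<noteq> [] \<and> last v = f"
proof -
  obtain S where S: "complete_prefix_set M S" "\<And>u. u \<in> S \<Longrightarrow> follower_set M u = mc_tree M"
    using assms(1) unfolding complete_recursive_tree_def by blast
  have "v \<noteq> [] \<and> last v = f" if v: "v \<in> S" for v
  proof -
    have "v \<noteq> []" using S(1) v by (auto simp: complete_prefix_set_def)
    moreover have "M $ last v $ g = 1" for g
    proof -
      have "[g] \<in> follower_set M v"
        unfolding S(2)[OF v] by (simp add: mc_tree_eq)
      then show ?thesis
        using \<open>v \<noteq> []\<close> by (simp add: follower_set_def mc_tree_eq successively_append_iff)
    qed
    ultimately show ?thesis using assms(3) by (auto simp: full_row_def)
  qed
  then show thesis using that S(1) by blast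
qed

lemma prefixes_recurrent:
  assumes S: "complete_prefix_set M S" "\<And>v. v \<in> S \<Longrightarrow> v \<noteq> [] \<and> last v = f"
    and "successively (\<lambda>f g. M $ f $ g = 1) w" "length w = Max (length ` S)"
  shows "f \<in> set w"
proof -
  have "w \<in> mc_tree M" using assms(3) by (simp add: mc_tree_eq)
  then obtain v where "v \<in> S" "prefix v w"
    using S(1) assms(4) unfolding complete_prefix_set_def by (metis order_refl)
  then show ?thesis
    using S(2) last_in_set set_mono_prefix by blast
qed

text \<open>
  Otherwise every word that ends in \<open>f\<close> is a power of \<open>f\<close>, and so the antichain \<open>S\<close> consists of one word
  \<open>f \<dots> f\<close> of maximal length. But replacing its last letter by \<open>g\<close> gives a word of the same
  length without a prefix in \<open>S\<close>.
\<close>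

lemma prefixes_return:
  assumes S: "complete_prefix_set M S" "\<And>v. v \<in> S \<Longrightarrow> v \<noteq> [] \<and> last v = f"
    and "full_row M f" "g \<noteq> f"
  shows "\<exists>g. g \<noteq> f \<and> M $ g $ f = 1"
proof (rule ccontr)
  let ?R = "\<lambda>f g. M $ f $ g = 1"
  assume "\<not> ?thesis"
  then have no_return: "\<And>g. M $ g $ f = 1 \<Longrightarrow> g = f" by blast
  have only_f: "set w \<subseteq> {f}" if "successively ?R w" "w \<noteq> []" "last w = f" for w
    using that
  proof (induction w)
    case (Cons a w)
    show ?case
    proof (cases w)
      case (Cons b w')
      then have "set w \<subseteq> {f}" using Cons.IH Cons.prems by auto
      then show ?thesis using Cons Cons.prems no_return by auto
    qed (use Cons.prems in simp)
  qed simp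
  have replicate: "v = replicate (length v) f" if "v \<in> S" for v
  proof -
    have "v \<in> mc_tree M" using S(1) that by (auto simp: complete_prefix_set_def)
    then have "set v \<subseteq> {f}" using only_f S(2)[OF that] by (simp add: mc_tree_eq)
    then show ?thesis by (metis replicate_length_same singletonD subsetD)
  qed
  have "finite S" "S \<noteq> {}" using S(1) by (auto simp: complete_prefix_set_def)
  then have "Max (length ` S) \<in> length ` S" by (intro Max_in) auto
  then obtain v where v: "v \<in> S" "length v = Max (length ` S)" by auto
  obtain n where n: "length v = Suc n" using S(2)[OF v(1)] by (cases v) auto
  have "successively ?R (replicate n f)" "last (replicate n f) = f \<or> n = 0"
    using \<open>full_row M f\<close> by (auto simp: successively_conv_nth full_row_def)
  then have "replicate n f @ [g] \<in> mc_tree M"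
    using \<open>full_row M f\<close> by (auto simp: mc_tree_eq successively_append_iff full_row_def)
  then obtain v' where v': "v' \<in> S" "prefix v' (replicate n f @ [g])"
    using S(1) v n unfolding complete_prefix_set_def
    by (metis length_append_singleton length_replicate order_refl)
  then have "prefix v' (replicate n f)"
    using S(2)[OF v'(1)] \<open>g \<noteq> f\<close> by (metis last_snoc prefix_snoc)
  then have "length v' \<le> n" using prefix_length_le by fastforce
  have "prefix v' v"
    using \<open>prefix v' (replicate n f)\<close> replicate[OF v(1)] n
    by (metis prefix_order.trans prefixI replicate_Suc replicate_append_same)
  moreover have "v' \<noteq> v" using \<open>length v' \<le> n\<close> n by auto
  ultimately show False
    using S(1) v(1) v'(1) by (auto simp: complete_prefix_set_def)
qed

section \<open>Strip entropy and entropy\<close>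

theorem theorem2:
  fixes A :: "real ^ 'k ^ 'k" and M :: "real ^ 'd ^ 'd" and p :: "nat \<Rightarrow> 'd list"
  assumes "zero_one_matrix A" and "primitive_matrix A"
    and "zero_one_matrix M" and "complete_recursive_tree M" and "\<exists>!f. full_row M f"
    and "p \<in> tree_boundary M" and "eventually_periodic p"
  shows "(\<lambda>n. strip_entropy A M n p) \<longlonglongrightarrow> ereal (tree_entropy A M)"
proof -
  define E where "E = (\<lambda>i j. A $ i $ j = 1)"
  define R where "R = (\<lambda>f g. M $ f $ g = 1)"
  obtain f where f: "full_row M f" "\<And>g. full_row M g \<Longrightarrow> g = f" using assms(5) by blast
  obtain S where S: "complete_prefix_set M S" "\<And>v. v \<in> S \<Longrightarrow> v \<noteq> [] \<and> last v = f"
    using complete_recursive_tree_prefixes[OF assms(4) f] by blast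
  obtain q where q: "1 \<le> q" "\<And>i j. 0 < matrix_power A q $ i $ j"
    using assms(2) by (auto simp: primitive_matrix_def)
  have walks: "(E ^^ q) i j" for i j
    unfolding E_def using positive_power_entry_walk[OF assms(1)] q(2)[of i j] by simp
  interpret hom_entropy R f "Max (length ` S)" E q
  proof
    show "R f g" for g using f(1) by (simp add: R_def full_row_def)
    show "f \<in> set w" if "successively R w" "length w = Max (length ` S)" for w
      using prefixes_recurrent[OF S] that by (simp add: R_def)
    show "\<exists>j. E i j" for i
      using walks[of i i] q(1) by (metis relpowp_Suc_D2 Suc_le_D One_nat_def)
    show "(E ^^ q) i j" for i j by (rule walks)
  qed
  have tree: "mc_tree M = {w. successively R w}"
    and level: "tree_level M n = {w. length w = n \<and> successively R w}" for n
    by (simp_all add: mc_tree_eq tree_level_def R_def)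
  have ball: "tree_ball M n = limb f n" for n
    by (auto simp: tree_ball_def level limb_def successively_full)
  have count: "ln (real (card (patterns F (hom_tree_shift A M)))) = log_total F"
    if "is_tree F" "F \<subseteq> mc_tree M" for F
    using card_patterns[of A F M, folded E_def, OF serial_graph_axioms that]
    by (simp add: log_total_def)
  obtain x where x: "\<And>n. p n = map x [1..<Suc n]" and levels: "\<And>n. p n \<in> tree_level M n"
    using assms(6) unfolding tree_boundary_def spelled_by_def by blast
  \<comment> \<open>The root behaves like a vertex with last letter \<open>f\<close>, so \<open>f\<close> is put in front of the ray.\<close>
  define y where "y = x(0 := f)"
  have p: "p n = map y [1..<Suc n]" for n
    unfolding x y_def by (rule map_cong) auto
  have p_admissible: "successively R (map y [1..<Suc n])" for n
    using levels[of n] by (simp add: level p del: upt_Suc)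
  have y: "R (y j) (y (Suc j))" for j
  proof (cases j)
    case 0
    then show ?thesis by (simp add: y_def full)
  next
    case (Suc i)
    then show ?thesis
      using p_admissible[of "Suc j"] by (simp add: successively_append_iff)
  qed
  have extend: "p j @ w \<in> mc_tree M \<longleftrightarrow> successively R (y j # w)" for j w
  proof (cases j)
    case 0
    then show ?thesis by (simp add: p tree successively_full y_def)
  next
    case (Suc i)
    have "p j = map y [1..<j] @ [y j]" by (simp add: p Suc)
    then show ?thesis
      using p_admissible[of j]
      by (cases w) (auto simp: tree successively_append_iff p simp del: upt_Suc)
  qed
  have strip: "strip M p n m = spine y n m" if "1 \<le> n" for n m
  proof -
    have "p j @ [hd w] = p (Suc j) \<longleftrightarrow> hd w = y (Suc j)" for j w
      by (simp add: p)
    moreover have "length (p j @ w) \<le> j + n - 1 \<longleftrightarrow> length w < n" for j w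
      using that by (auto simp: p simp del: upt_Suc)
    ultimately show ?thesis
      unfolding strip_def branch_def spine_def extend by (auto simp: p simp del: upt_Suc)
  qed
  have strip_ratio: "ln (real (card (patterns (strip M p n m) (hom_tree_shift A M))))
      / real (card (strip M p n m)) = log_total (spine y n m) / real (card (spine y n m))"
    if "1 \<le> n" "0 < m" for n m
  proof -
    have "spine y n m \<subseteq> mc_tree M"
      unfolding strip[OF that(1), symmetric] strip_def branch_def by blast
    then show ?thesis
      using count[OF is_tree_spine] that by (simp add: strip)
  qed
  have "(\<forall>g. g = f) \<or> (\<exists>g. g \<noteq> f \<and> R g f)"
    using prefixes_return[OF S f(1)] by (auto simp: R_def)
  then obtain h where h: "(\<lambda>n. log_total (limb f n) / real (card (limb f n))) \<longlonglongrightarrow> h"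
    "\<And>\<epsilon>. 0 < \<epsilon> \<Longrightarrow> \<exists>n0. \<forall>n\<ge>n0. \<forall>y. (\<forall>j. R (y j) (y (Suc j))) \<longrightarrow>
      (\<forall>\<^sub>F m in sequentially.
        \<bar>log_total (spine y n m) / real (card (spine y n m)) - h\<bar> \<le> \<epsilon>)"
    using spine_entropy by blast
  have "tree_entropy A M = h"
  proof -
    have "limb f n \<subseteq> mc_tree M" for n
      by (auto simp: limb_def tree successively_full)
    then show ?thesis
      unfolding tree_entropy_def ball using count[OF is_tree_limb] h(1) by (simp add: limI)
  qed
  have close: "\<exists>n0. \<forall>n\<ge>n0. ereal (h - \<epsilon>) \<le> strip_entropy A M n p \<and>
      strip_entropy A M n p \<le> ereal (h + \<epsilon>)" if "0 < \<epsilon>" for \<epsilon>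
  proof -
    obtain n0 where n0: "\<And>n. n0 \<le> n \<Longrightarrow> \<forall>\<^sub>F m in sequentially.
        \<bar>log_total (spine y n m) / real (card (spine y n m)) - h\<bar> \<le> \<epsilon>"
      using h(2)[OF \<open>0 < \<epsilon>\<close>] y by blast
    have "ereal (h - \<epsilon>) \<le> strip_entropy A M n p \<and> strip_entropy A M n p \<le> ereal (h + \<epsilon>)"
      if "max 1 n0 \<le> n" for n
    proof -
      have n: "1 \<le> n" "n0 \<le> n" using that by auto
      have "\<forall>\<^sub>F m in sequentially. \<bar>ln (real (card (patterns (strip M p n m) (hom_tree_shift A M))))
          / real (card (strip M p n m)) - h\<bar> \<le> \<epsilon>"
        using n0[OF n(2)] eventually_gt_at_top[of 0]
        by eventually_elim (simp only: strip_ratio[OF n(1)])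
      then show ?thesis
        unfolding strip_entropy_def
        by (auto intro!: le_Limsup Limsup_bounded elim!: eventually_mono)
    qed
    then show ?thesis by blast
  qed
  show ?thesis
    unfolding \<open>tree_entropy A M = h\<close>
  proof (rule order_tendstoI)
    fix a assume "a < ereal h"
    then obtain r where r: "a < ereal r" "r < h" using ereal_dense2 by fastforce
    then obtain n0 where "\<forall>n\<ge>n0. ereal (h - (h - r)) \<le> strip_entropy A M n p"
      using close[of "h - r"] by auto
    then show "\<forall>\<^sub>F n in sequentially. a < strip_entropy A M n p"
      using r unfolding eventually_sequentially by (intro exI[of _ n0]) (auto intro: less_le_trans)
  next
    fix a assume "ereal h < a"
    then obtain r where r: "ereal r < a" "h < r" using ereal_dense2 by fastforce
    then obtain n0 where "\<forall>n\<ge>n0. strip_entropy A M n p \<le> ereal (h + (r - h))"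
      using close[of "r - h"] by auto
    then show "\<forall>\<^sub>F n in sequentially. strip_entropy A M n p < a"
      using r unfolding eventually_sequentially by (intro exI[of _ n0]) (auto intro: le_less_trans)
  qed
qed

end
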